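(* Let $K=K_1\mathbf{e_1}+K_2\mathbf{e_2}$ be a product-type compact subset of $\mathbb{BC}$ and let $F\in\mathcal{A}(K)$. Let $\varepsilon>0$ be a real number. (i) If the complement of $K$ is of type $\mathcal{T}_1$ with finitely many components, and $P\subset\mathcal{T}_1$ contains one point from each connected component of $\mathcal{T}_1$, then there is a bicomplex rational function $R$ with bicomplex poles only in $P$ such that $$\sup_{Z\in K}|F(Z)-R(Z)|_{\mathbf{k}}\prec\varepsilon.$$ (ii) If the complement of $K$ is of type $\mathcal{T}_2$ with finitely many components, then there is a bicomplex rational function $R(\beta_1\mathbf{e_1}+\beta_2\mathbf{e_2})=R_1(\beta_1)\mathbf{e_1}+P_2(\beta_2)\mathbf{e_2}$, where $R_1$ is a rational function on $\mathbb{C}(\mathbf{i})$ and $P_2$ is a polynomial on $\mathbb{C}(\mathbf{i})$, with bicomplex poles of the form $\beta_1\mathbf{e_1}+\infty\mathbf{e_2}\in\overline{\mathbb{BC}}\setminus(K\cup\mathcal{O})$, $\beta_1\in\mathbb{C}(\mathbf{i})\setminus K_1$, such that $$\sup_{Z\in K}|F(Z)-R(Z)|_{\mathbf{k}}\prec\varepsilon.$$ (iii) If the complement of $K$ is of type $\mathcal{T}_3$ with finitely many components, then there is a bicomplex rational function $R(\beta_1\mathbf{e_1}+\beta_2\mathbf{e_2})=P_1(\beta_1)\mathbf{e_1}+R_2(\beta_2)\mathbf{e_2}$, where $P_1$ is a polynomial on $\mathbb{C}(\mathbf{i})$ and $R_2$ is a rational function on $\mathbb{C}(\mathbf{i})$,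 with bicomplex poles of the form $\infty\mathbf{e_1}+\beta_2\mathbf{e_2}\in\overline{\mathbb{BC}}\setminus(K\cup\mathcal{O})$, $\beta_2\in\mathbb{C}(\mathbf{i})\setminus K_2$, such that $$\sup_{Z\in K}|F(Z)-R(Z)|_{\mathbf{k}}\prec\varepsilon.$$ (iv) If the complement of $K$ is of type $\mathcal{T}_4$, then there is a bicomplex polynomial $P$, with bicomplex pole $\infty\mathbf{e_1}+\infty\mathbf{e_2}\in\overline{\mathbb{BC}}\setminus(K\cup\mathcal{O})$, such that $$\sup_{Z\in K}|F(Z)-P(Z)|_{\mathbf{k}}\prec\varepsilon.$$
   Context: Bicomplex numbers: $\mathbb{BC}=\{Z_1+\mathbf{j}Z_2: Z_1,Z_2\in\mathbb{C}(\mathbf{i})\}$, where $\mathbf{i}\neq\mathbf{j}$, $\mathbf{i}\mathbf{j}=\mathbf{j}\mathbf{i}=\mathbf{k}$, $\mathbf{i}^2=\mathbf{j}^2=-1$, and $\mathbb{C}(\mathbf{i})$ is the complex field with imaginary unit $\mathbf{i}$. Put $\mathbf{e_1}=\frac12(1+\mathbf{k})$, $\mathbf{e_2}=\frac12(1-\mathbf{k})$; these satisfy $\mathbf{e_1}+\mathbf{e_2}=1$, $\mathbf{e_1}\mathbf{e_2}=0$, $\mathbf{e_l}^2=\mathbf{e_l}$. Every $Z\in\mathbb{BC}$ is written uniquely as $Z=\beta_1\mathbf{e_1}+\beta_2\mathbf{e_2}$ with $\beta_1=Z_1-\mathbf{i}Z_2$, $\beta_2=Z_1+\mathbf{i}Z_2$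 in $\mathbb{C}(\mathbf{i})$; write $\Pi_{l}(Z)=\beta_l$. This identifies $\mathbb{BC}$ with $\mathbb{C}(\mathbf{i})\times\mathbb{C}(\mathbf{i})$, with componentwise operations. $\mathcal{O}\subset\mathbb{BC}$ is the set of zero divisors (nonzero $Z$ with $\beta_1=0$ or $\beta_2=0$). The extended set $\overline{\mathbb{BC}}$ is $\mathbb{BC}$ together with the infinite elements $\infty\mathbf{e_1}+\beta_2\mathbf{e_2}$, $\beta_1\mathbf{e_1}+\infty\mathbf{e_2}$ ($\beta_1,\beta_2\in\mathbb{C}(\mathbf{i})$), and $\infty\mathbf{e_1}+\infty\mathbf{e_2}$. The hyperbolic-valued norm is $|Z|_{\mathbf{k}}=|\beta_1|\mathbf{e_1}+|\beta_2|\mathbf{e_2}$. For $a=a_1\mathbf{e_1}+a_2\mathbf{e_2}$, $b=b_1\mathbf{e_1}+b_2\mathbf{e_2}$ with real $a_l,b_l$, $a\prec b$ means $a_1<b_1$ and $a_2<b_2$; suprema of such hyperbolic numbers are componentwise; a real number $c$ is identified with $c\,\mathbf{e_1}+c\,\mathbf{e_2}$. A product-type compact set is $K=K_1\mathbf{e_1}+K_2\mathbf{e_2}$ (also written $K_1\times K_2$) with $K_1,K_2\subset\mathbb{C}(\mathbf{i})$ compact. For $l=1,2$, $\mathcal{A}(K_l)$ is the space of complex-valued functions continuous on $K_l$ and holomorphic in the interior of $K_l$. $\mathcal{A}(K)=\mathcal{A}(K_1)\mathbf{e_1}+\mathcal{A}(K_2)\mathbf{e_2}$ is the set of functions $F(\beta_1\mathbf{e_1}+\beta_2\mathbf{e_2})=F_1(\beta_1)\mathbf{e_1}+F_2(\beta_2)\mathbf{e_2}$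 on $K$ with $F_l\in\mathcal{A}(K_l)$. Types of complement: the complement of $K$ is understood as the product set $(\mathbb{C}(\mathbf{i})\setminus K_1)\times(\mathbb{C}(\mathbf{i})\setminus K_2)=(\mathbb{C}(\mathbf{i})\setminus K_1)\mathbf{e_1}+(\mathbb{C}(\mathbf{i})\setminus K_2)\mathbf{e_2}$, and this set is denoted $\mathcal{T}_1,\mathcal{T}_2,\mathcal{T}_3,\mathcal{T}_4$ respectively in the following cases (in the versions with finitely many components): type $\mathcal{T}_1$ when both $\mathbb{C}(\mathbf{i})\setminus K_1$ and $\mathbb{C}(\mathbf{i})\setminus K_2$ have finitely many components; type $\mathcal{T}_2$ when $\mathbb{C}(\mathbf{i})\setminus K_1$ has finitely many components and $\mathbb{C}(\mathbf{i})\setminus K_2$ is connected; type $\mathcal{T}_3$ when $\mathbb{C}(\mathbf{i})\setminus K_1$ is connected and $\mathbb{C}(\mathbf{i})\setminus K_2$ has finitely many components; type $\mathcal{T}_4$ when both are connected. A bicomplex rational function (resp. polynomial) is a product-type function $R(\beta_1\mathbf{e_1}+\beta_2\mathbf{e_2})=R_1(\beta_1)\mathbf{e_1}+R_2(\beta_2)\mathbf{e_2}$ with $R_1,R_2$ complex rational functions (resp. polynomials). Statements about bicomplex poles are understood componentwise: in (i), "bicomplex poles only in $P$" means that for $l=1,2$ all poles of $R_l$ lie in $P_l=\Pi_l(P)\subset\mathbb{C}(\mathbf{i})\setminus K_l$; in (ii), that all poles of $R_1$ lie in $\mathbb{C}(\mathbf{i})\setminus K_1$, while the polynomial second component has no pole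 except possibly at $\infty$; (iii) is the same with the roles of the components exchanged; in (iv), both components are polynomials, with no pole except possibly at $\infty$. *)

theory Defs
  imports "HOL-Complex_Analysis.Complex_Analysis" "HOL-Computational_Algebra.Polynomial"
begin

section \<open>Bicomplex numbers\<close>

text \<open>\<open>Bicomplex Z1 Z2\<close> is \<open>Z1 + j Z2\<close>, where \<open>Z1\<close>, \<open>Z2\<close> are complex numbers in the unit \<open>i\<close>.\<close>

datatype bicomplex = Bicomplex (bc_Z1: complex) (bc_Z2: complex)

instantiation bicomplex :: comm_ring_1
begin

definition "0 = Bicomplex 0 0"
definition "1 = Bicomplex 1 0"
definition "Z + W = Bicomplex (bc_Z1 Z + bc_Z1 W) (bc_Z2 Z + bc_Z2 W)"
definition "Z - W = Bicomplex (bc_Z1 Z - bc_Z1 W) (bc_Z2 Z - bc_Z2 W)"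
definition "- Z = Bicomplex (- bc_Z1 Z) (- bc_Z2 Z)"
definition "Z * W = Bicomplex (bc_Z1 Z * bc_Z1 W - bc_Z2 Z * bc_Z2 W)
                              (bc_Z1 Z * bc_Z2 W + bc_Z2 Z * bc_Z1 W)"

instance
  by standard
    (simp_all add: zero_bicomplex_def one_bicomplex_def plus_bicomplex_def minus_bicomplex_def
       uminus_bicomplex_def times_bicomplex_def algebra_simps)

end

definition bc_of_complex :: "complex \<Rightarrow> bicomplex" where
  "bc_of_complex z = Bicomplex z 0"

definition bc_i :: bicomplex where "bc_i = bc_of_complex \<i>"
definition bc_j :: bicomplex where "bc_j = Bicomplex 0 1"
definition bc_k :: bicomplex where "bc_k = bc_i * bc_j"

definition bc_e1 :: bicomplex where "bc_e1 = bc_of_complex (1/2) * (1 + bc_k)"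
definition bc_e2 :: bicomplex where "bc_e2 = bc_of_complex (1/2) * (1 - bc_k)"

definition bc_Pi1 :: "bicomplex \<Rightarrow> complex" where
  "bc_Pi1 Z = bc_Z1 Z - \<i> * bc_Z2 Z"

definition bc_Pi2 :: "bicomplex \<Rightarrow> complex" where
  "bc_Pi2 Z = bc_Z1 Z + \<i> * bc_Z2 Z"

definition bc_idem :: "complex \<Rightarrow> complex \<Rightarrow> bicomplex" where
  "bc_idem \<beta>1 \<beta>2 = bc_of_complex \<beta>1 * bc_e1 + bc_of_complex \<beta>2 * bc_e2"

lemmas bc_defs = zero_bicomplex_def one_bicomplex_def plus_bicomplex_def minus_bicomplex_def
  uminus_bicomplex_def times_bicomplex_def bc_of_complex_def bc_i_def bc_j_def bc_k_def
  bc_e1_def bc_e2_def bc_Pi1_def bc_Pi2_def bc_idem_def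

lemma bc_units: "bc_i * bc_i = -1" "bc_j * bc_j = -1" "bc_j * bc_i = bc_k"
  by (simp_all add: bc_defs)

lemma bc_e_idempotent:
  "bc_e1 + bc_e2 = 1" "bc_e1 * bc_e2 = 0" "bc_e1 * bc_e1 = bc_e1" "bc_e2 * bc_e2 = bc_e2"
  by (simp_all add: bc_defs field_simps)

lemma bc_Pi_idem [simp]: "bc_Pi1 (bc_idem a b) = a" "bc_Pi2 (bc_idem a b) = b"
  by (simp_all add: bc_defs field_simps)

lemma bc_idem_Pi [simp]: "bc_idem (bc_Pi1 Z) (bc_Pi2 Z) = Z"
  by (cases Z) (simp add: bc_defs field_simps)

lemma bc_Pi_arith [simp]:
  "bc_Pi1 (Z + W) = bc_Pi1 Z + bc_Pi1 W" "bc_Pi2 (Z + W) = bc_Pi2 Z + bc_Pi2 W"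
  "bc_Pi1 (Z - W) = bc_Pi1 Z - bc_Pi1 W" "bc_Pi2 (Z - W) = bc_Pi2 Z - bc_Pi2 W"
  "bc_Pi1 (Z * W) = bc_Pi1 Z * bc_Pi1 W" "bc_Pi2 (Z * W) = bc_Pi2 Z * bc_Pi2 W"
  by (simp_all add: bc_defs algebra_simps)

lemma bc_of_complex_idem: "bc_of_complex c = bc_idem c c"
  by (simp add: bc_defs field_simps)

text \<open>The topology is that of \<open>\<complex> \<times> \<complex>\<close>, in the coordinates \<open>(Z1, Z2)\<close>.\<close>

instantiation bicomplex :: topological_space
begin

definition open_bicomplex :: "bicomplex set \<Rightarrow> bool" where
  "open_bicomplex U \<longleftrightarrow> open ((\<lambda>(z, w). Bicomplex z w) -` U)"

instance
  by standard (auto simp: open_bicomplex_def vimage_Union)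

end

lemma continuous_on_bc_Pi: "continuous_on A bc_Pi1" "continuous_on A bc_Pi2"
proof -
  have 1: "continuous_on UNIV (\<lambda>(z, w). z - \<i> * w :: complex)"
    and 2: "continuous_on UNIV (\<lambda>(z, w). z + \<i> * w :: complex)"
    by (auto simp: case_prod_unfold intro!: continuous_intros)
  have "continuous_on UNIV bc_Pi1" "continuous_on UNIV bc_Pi2"
    using 1 2
    by (auto simp: continuous_on_open_vimage open_bicomplex_def bc_Pi1_def bc_Pi2_def
          vimage_def case_prod_unfold)
  then show "continuous_on A bc_Pi1" "continuous_on A bc_Pi2"
    using continuous_on_subset by blast+
qed

section \<open>Hyperbolic numbers\<close>

definition hyperbolic :: "bicomplex set" where
  "hyperbolic = {Z. bc_Pi1 Z \<in> \<real> \<and> bc_Pi2 Z \<in> \<real>}"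

definition hnorm :: "bicomplex \<Rightarrow> bicomplex" where
  "hnorm Z = bc_idem (of_real (cmod (bc_Pi1 Z))) (of_real (cmod (bc_Pi2 Z)))"

definition hless :: "bicomplex \<Rightarrow> bicomplex \<Rightarrow> bool"  (infix \<open>\<prec>\<^sub>h\<close> 50) where
  "a \<prec>\<^sub>h b \<longleftrightarrow> a \<in> hyperbolic \<and> b \<in> hyperbolic \<and>
     Re (bc_Pi1 a) < Re (bc_Pi1 b) \<and> Re (bc_Pi2 a) < Re (bc_Pi2 b)"

text \<open>Least upper bound of a set of non-negative reals, taken within \<open>[0, \<infinity>)\<close>: the supremum
  of the empty set is \<open>0\<close>, and an unbounded set has no supremum.\<close>

definition is_nonneg_sup :: "real set \<Rightarrow> real \<Rightarrow> bool" where
  "is_nonneg_sup A s \<longleftrightarrow> 0 \<le> s \<and> (\<forall>x\<in>A. x \<le> s) \<and> (\<forall>c\<ge>0. (\<forall>x\<in>A. x \<le> c) \<longrightarrow> s \<le> c)"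

lemma is_nonneg_sup_Sup:
  assumes "A \<noteq> {}" "bdd_above A" "\<forall>x\<in>A. 0 \<le> x"
  shows "is_nonneg_sup A s \<longleftrightarrow> s = Sup A"
proof -
  have "is_nonneg_sup A (Sup A)"
    unfolding is_nonneg_sup_def
    by (metis all_not_in_conv assms cSup_least cSup_upper order_trans)
  moreover from this have "s = Sup A" if "is_nonneg_sup A s"
    using that unfolding is_nonneg_sup_def by (meson order_antisym)
  ultimately show ?thesis by blast
qed

text \<open>\<open>s\<close> is the componentwise supremum of a set \<open>S\<close> of hyperbolic numbers with non-negative
  components.\<close>

definition is_hsup :: "bicomplex set \<Rightarrow> bicomplex \<Rightarrow> bool" where
  "is_hsup S s \<longleftrightarrow> s \<in> hyperbolic \<and>
     is_nonneg_sup ((\<lambda>Z. Re (bc_Pi1 Z)) ` S) (Re (bc_Pi1 s)) \<and>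
     is_nonneg_sup ((\<lambda>Z. Re (bc_Pi2 Z)) ` S) (Re (bc_Pi2 s))"

definition hsup_dist_less ::
    "bicomplex set \<Rightarrow> (bicomplex \<Rightarrow> bicomplex) \<Rightarrow> (bicomplex \<Rightarrow> bicomplex) \<Rightarrow> real \<Rightarrow> bool" where
  "hsup_dist_less K F R \<epsilon> \<longleftrightarrow>
     (\<exists>s. is_hsup ((\<lambda>Z. hnorm (F Z - R Z)) ` K) s \<and> s \<prec>\<^sub>h bc_of_complex (of_real \<epsilon>))"

section \<open>Product-type sets and functions\<close>

definition idem_prod :: "complex set \<Rightarrow> complex set \<Rightarrow> bicomplex set" where
  "idem_prod A B = {bc_idem \<beta>1 \<beta>2 | \<beta>1 \<beta>2. \<beta>1 \<in> A \<and> \<beta>2 \<in> B}"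

definition idem_fun :: "(complex \<Rightarrow> complex) \<Rightarrow> (complex \<Rightarrow> complex) \<Rightarrow> bicomplex \<Rightarrow> bicomplex" where
  "idem_fun f g Z = bc_idem (f (bc_Pi1 Z)) (g (bc_Pi2 Z))"

definition alg_A :: "complex set \<Rightarrow> (complex \<Rightarrow> complex) set" where
  "alg_A K = {f. continuous_on K f \<and> f holomorphic_on interior K}"

text \<open>Functions are total in HOL; membership only constrains the values on \<open>K1 e1 + K2 e2\<close>.\<close>

definition bc_alg_A :: "complex set \<Rightarrow> complex set \<Rightarrow> (bicomplex \<Rightarrow> bicomplex) set" where
  "bc_alg_A K1 K2 = {F. \<exists>F1\<in>alg_A K1. \<exists>F2\<in>alg_A K2. \<forall>Z\<in>idem_prod K1 K2. F Z = idem_fun F1 F2 Z}"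

text \<open>The complement of \<open>K1 e1 + K2 e2\<close> in the product sense (not the set-theoretic complement),
  and its four types.\<close>

definition prod_compl :: "complex set \<Rightarrow> complex set \<Rightarrow> bicomplex set" where
  "prod_compl K1 K2 = idem_prod (- K1) (- K2)"

definition compl_type1 :: "complex set \<Rightarrow> complex set \<Rightarrow> bool" where
  "compl_type1 K1 K2 \<longleftrightarrow> finite (components (- K1)) \<and> finite (components (- K2))"

definition compl_type2 :: "complex set \<Rightarrow> complex set \<Rightarrow> bool" where
  "compl_type2 K1 K2 \<longleftrightarrow> finite (components (- K1)) \<and> connected (- K2)"

definition compl_type3 :: "complex set \<Rightarrow> complex set \<Rightarrow> bool" where
  "compl_type3 K1 K2 \<longleftrightarrow> connected (- K1) \<and> finite (components (- K2))"

definition compl_type4 :: "complex set \<Rightarrow> complex set \<Rightarrow> bool" where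
  "compl_type4 K1 K2 \<longleftrightarrow> connected (- K1) \<and> connected (- K2)"

section \<open>Rational functions, polynomials and their poles\<close>

text \<open>A rational function is a quotient in lowest terms, so that removable singularities are
  filled in; its values at its poles are irrelevant.\<close>

definition complex_rational :: "(complex \<Rightarrow> complex) \<Rightarrow> bool" where
  "complex_rational f \<longleftrightarrow>
     (\<exists>p q. q \<noteq> 0 \<and> coprime p q \<and> (\<forall>z. poly q z \<noteq> 0 \<longrightarrow> f z = poly p z / poly q z))"

definition complex_polynomial :: "(complex \<Rightarrow> complex) \<Rightarrow> bool" where
  "complex_polynomial f \<longleftrightarrow> (\<exists>p. f = poly p)"

datatype ext_complex = Fin complex | Infty

definition poles :: "(complex \<Rightarrow> complex) \<Rightarrow> ext_complex set" where
  "poles f = {Fin z | z. is_pole f z} \<union> (if filterlim f at_infinity at_infinity then {Infty} else {})"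

end

theory Submission
  imports Defs
begin

text \<open>
  Everything happens componentwise, so the point is Mergelyan's theorem for a compact plane set \<open>K\<close>
  whose complement has finitely many components. Extend \<open>f\<close> to a continuous function with compact
  support, and lay a fine square grid of side \<open>\<delta>\<close> over the plane. By Cauchy's theorem, only the cells
  \<open>S\<close> that are not contained in the interior of \<open>K\<close> contribute to the sum of the Cauchy integrals of
  \<open>f\<close> over cells away from \<open>z\<close>, and the cells near \<open>z\<close> produce \<open>f z\<close> up to the oscillation of \<open>f\<close>.
  The contribution of such an \<open>S\<close> is replaced by \<open>\<alpha> g + \<beta> g\<^sup>2\<close> with the same first two Laurent
  coefficients at infinity, where \<open>g\<close> is bounded by a multiple of \<open>1/\<delta>\<close>, close to \<open>1 / (z - c)\<close>
  far away, and a uniform limit of admissible rational functions; the errors then decay like the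
  inverse cube of the distance and can be summed over the grid. The function \<open>g\<close> is explicit: near
  \<open>S\<close> the complement of \<open>K\<close> contains a connected set joining points \<open>q\<close> and \<open>b\<close> at distance \<open>\<delta>\<close>, so
  that \<open>(z - q) (z - b)\<close> has a square root \<open>h\<close> on \<open>K\<close>, and \<open>g\<close> is a multiple of \<open>z - c - h z\<close>
  with \<open>c\<close> the midpoint of \<open>q\<close> and \<open>b\<close>.
\<close>

section \<open>Uniformly closed algebras of functions\<close>

text \<open>Scalars and subtraction come from \<open>const\<close> together with \<open>mult\<close>
  and \<open>add\<close>. Two instances of \<open>B\<close> occur later: the fractions
  \<open>1 / (z - p)\<close> with \<open>p \<in> P\<close>, whose algebra consists of rational
  functions, and the identity alone, whose algebra consists of polynomials.\<close>

inductive_set gen_alg :: "(complex \<Rightarrow> complex) set \<Rightarrow> (complex \<Rightarrow> complex) set"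
  for B :: "(complex \<Rightarrow> complex) set" where
  const: "(\<lambda>_. c) \<in> gen_alg B"
| gen: "b \<in> B \<Longrightarrow> b \<in> gen_alg B"
| add: "f \<in> gen_alg B \<Longrightarrow> g \<in> gen_alg B \<Longrightarrow> (\<lambda>z. f z + g z) \<in> gen_alg B"
| mult: "f \<in> gen_alg B \<Longrightarrow> g \<in> gen_alg B \<Longrightarrow> (\<lambda>z. f z * g z) \<in> gen_alg B"

locale uniform_algebra =
  fixes K :: "complex set" and B :: "(complex \<Rightarrow> complex) set"
  assumes gen_bounded: "b \<in> B \<Longrightarrow> bounded (b ` K)"
begin

text \<open>The uniform closure on \<open>K\<close>, realised as a set of total functions: values
  off \<open>K\<close> are unconstrained, so a member may be replaced by any function that agrees
  with it on \<open>K\<close>.\<close>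

definition clo :: "(complex \<Rightarrow> complex) set" where
  "clo = {f. \<forall>\<epsilon>>0. \<exists>r\<in>gen_alg B. \<forall>z\<in>K. cmod (f z - r z) < \<epsilon>}"

lemma cloD:
  assumes "f \<in> clo" "\<epsilon> > 0"
  obtains r where "r \<in> gen_alg B" "\<And>z. z \<in> K \<Longrightarrow> cmod (f z - r z) < \<epsilon>"
  using assms unfolding clo_def by blast

lemma gen_alg_bounded: "f \<in> gen_alg B \<Longrightarrow> \<exists>M>0. \<forall>z\<in>K. cmod (f z) \<le> M"
proof (induction rule: gen_alg.induct)
  case (const c)
  show ?case by (rule exI[of _ "cmod c + 1"]) (simp add: add_nonneg_pos)
next
  case (gen b)
  then show ?case using gen_bounded unfolding bounded_pos by auto
next
  case (add f g)
  then obtain M N where "M > 0" "N > 0" "\<forall>z\<in>K. cmod (f z) \<le> M" "\<forall>z\<in>K. cmod (g z) \<le> N" by blast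
  then show ?case by (intro exI[of _ "M+N"]) (auto intro: norm_triangle_mono)
next
  case (mult f g)
  then obtain M N where "M > 0" "N > 0" "\<forall>z\<in>K. cmod (f z) \<le> M" "\<forall>z\<in>K. cmod (g z) \<le> N" by blast
  then show ?case by (intro exI[of _ "M*N"]) (auto simp: norm_mult intro: mult_mono)
qed

lemma gen_alg_subset_clo: "f \<in> gen_alg B \<Longrightarrow> f \<in> clo"
  unfolding clo_def by force

lemma clo_const [simp, intro]: "(\<lambda>_. c) \<in> clo"
  by (intro gen_alg_subset_clo gen_alg.const)

lemma clo_limit:
  assumes "\<And>\<epsilon>. \<epsilon> > 0 \<Longrightarrow> \<exists>g\<in>clo. \<forall>z\<in>K. cmod (f z - g z) < \<epsilon>"
  shows "f \<in> clo"
  unfolding clo_def mem_Collect_eq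
proof (intro allI impI)
  fix \<epsilon> :: real assume "\<epsilon> > 0"
  then obtain g where g: "g \<in> clo" "\<forall>z\<in>K. cmod (f z - g z) < \<epsilon>/2" using assms[of "\<epsilon>/2"] by auto
  obtain r where "r \<in> gen_alg B" "\<And>z. z \<in> K \<Longrightarrow> cmod (g z - r z) < \<epsilon>/2"
    using cloD[OF g(1), of "\<epsilon>/2"] \<open>\<epsilon> > 0\<close> by auto
  moreover have "cmod (f z - r z) < \<epsilon>" if "z \<in> K" for z
    using norm_diff_triangle_less[of "f z" "g z" "\<epsilon>/2" "r z" "\<epsilon>/2"] g calculation(2) that by auto
  ultimately show "\<exists>r\<in>gen_alg B. \<forall>z\<in>K. cmod (f z - r z) < \<epsilon>" by blast
qed

lemma clo_cong: "f \<in> clo \<Longrightarrow> (\<And>z. z \<in> K \<Longrightarrow> f z = g z) \<Longrightarrow> g \<in> clo"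
  unfolding clo_def by simp

lemma clo_add:
  assumes "f \<in> clo" "g \<in> clo"
  shows "(\<lambda>z. f z + g z) \<in> clo"
  unfolding clo_def mem_Collect_eq
proof (intro allI impI)
  fix \<epsilon> :: real assume e: "\<epsilon> > 0"
  obtain r where r: "r \<in> gen_alg B" "\<And>z. z \<in> K \<Longrightarrow> cmod (f z - r z) < \<epsilon>/2"
    using cloD[OF assms(1), of "\<epsilon>/2"] e by auto
  obtain s where s: "s \<in> gen_alg B" "\<And>z. z \<in> K \<Longrightarrow> cmod (g z - s z) < \<epsilon>/2"
    using cloD[OF assms(2), of "\<epsilon>/2"] e by auto
  have "cmod (f z + g z - (r z + s z)) < \<epsilon>" if "z \<in> K" for z
  proof -
    have "f z + g z - (r z + s z) = (f z - r z) + (g z - s z)" by simp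
    then have "cmod (f z + g z - (r z + s z)) \<le> cmod (f z - r z) + cmod (g z - s z)"
      using norm_triangle_ineq[of "f z - r z" "g z - s z"] by metis
    then show ?thesis using r(2)[OF that] s(2)[OF that] by linarith
  qed
  then show "\<exists>r\<in>gen_alg B. \<forall>z\<in>K. cmod (f z + g z - r z) < \<epsilon>"
    by (intro bexI[OF _ gen_alg.add[OF r(1) s(1)]]) simp
qed

lemma clo_bounded:
  assumes "f \<in> clo"
  obtains M where "M > 0" "\<And>z. z \<in> K \<Longrightarrow> cmod (f z) \<le> M"
proof -
  obtain r where r: "r \<in> gen_alg B" "\<And>z. z \<in> K \<Longrightarrow> cmod (f z - r z) < 1"
    using cloD[OF assms, of 1] by auto
  obtain M where M: "M > 0" "\<forall>z\<in>K. cmod (r z) \<le> M" using gen_alg_bounded[OF r(1)] by blast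
  have "cmod (f z) \<le> M + 1" if "z \<in> K" for z
    using r(2)[OF that] M(2) that norm_triangle_sub[of "f z" "r z"] by force
  then show thesis using M(1) that[of "M+1"] by auto
qed

lemma clo_mult:
  assumes "f \<in> clo" "g \<in> clo"
  shows "(\<lambda>z. f z * g z) \<in> clo"
  unfolding clo_def mem_Collect_eq
proof (intro allI impI)
  fix \<epsilon> :: real assume e: "\<epsilon> > 0"
  obtain M where M: "M > 0" "\<And>z. z \<in> K \<Longrightarrow> cmod (g z) \<le> M" using clo_bounded[OF assms(2)] by auto
  obtain r where r: "r \<in> gen_alg B" "\<And>z. z \<in> K \<Longrightarrow> cmod (f z - r z) < \<epsilon>/(2*M)"
    using cloD[OF assms(1), of "\<epsilon>/(2*M)"] e M by auto
  obtain N where N: "N > 0" "\<forall>z\<in>K. cmod (r z) \<le> N" using gen_alg_bounded[OF r(1)] by blast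
  obtain s where s: "s \<in> gen_alg B" "\<And>z. z \<in> K \<Longrightarrow> cmod (g z - s z) < \<epsilon>/(2*N)"
    using cloD[OF assms(2), of "\<epsilon>/(2*N)"] e N by auto
  have "cmod (f z * g z - (r z * s z)) < \<epsilon>" if "z \<in> K" for z
  proof -
    have "f z * g z - (r z * s z) = (f z - r z) * g z + r z * (g z - s z)"
      by (simp add: algebra_simps)
    then have "cmod (f z * g z - (r z * s z))
        \<le> cmod (f z - r z) * cmod (g z) + cmod (r z) * cmod (g z - s z)"
      using norm_triangle_ineq[of "(f z - r z) * g z" "r z * (g z - s z)"] by (simp add: norm_mult)
    also have "cmod (f z - r z) * cmod (g z) \<le> \<epsilon>/(2*M) * M"
      using r(2)[OF that] M(2)[OF that] M(1) e by (intro mult_mono) auto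
    also have "cmod (r z) * cmod (g z - s z) \<le> N * cmod (g z - s z)"
      using N that by (intro mult_right_mono) auto
    also have "N * cmod (g z - s z) < N * (\<epsilon>/(2*N))"
      using s(2)[OF that] N by (intro mult_strict_left_mono) auto
    finally show ?thesis using M N by simp
  qed
  then show "\<exists>r\<in>gen_alg B. \<forall>z\<in>K. cmod (f z * g z - r z) < \<epsilon>"
    by (intro bexI[OF _ gen_alg.mult[OF r(1) s(1)]]) simp
qed

lemma clo_cmult: "f \<in> clo \<Longrightarrow> (\<lambda>z. c * f z) \<in> clo"
  by (rule clo_mult) auto

lemma clo_uminus: "f \<in> clo \<Longrightarrow> (\<lambda>z. - f z) \<in> clo"
  using clo_cmult[of f "-1"] by simp

lemma clo_diff: "f \<in> clo \<Longrightarrow> g \<in> clo \<Longrightarrow> (\<lambda>z. f z - g z) \<in> clo"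
  using clo_add[OF _ clo_uminus, of f g] by simp

lemma clo_power: "f \<in> clo \<Longrightarrow> (\<lambda>z. f z ^ n) \<in> clo"
  by (induction n) (auto intro: clo_mult)

lemma clo_sum: "(\<And>i. i \<in> I \<Longrightarrow> f i \<in> clo) \<Longrightarrow> (\<lambda>z. \<Sum>i\<in>I. f i z) \<in> clo"
  by (induction I rule: infinite_finite_induct) (auto intro: clo_add)

text \<open>By the Weierstrass M-test the partial sums, which lie in \<open>clo\<close>, converge
  uniformly on \<open>K\<close>. The exponential, geometric and logarithmic series are its three
  uses.\<close>

lemma clo_power_series:
  assumes u: "u \<in> clo" "\<And>z. z \<in> K \<Longrightarrow> cmod (u z) \<le> \<rho>"
    and sm: "summable (\<lambda>n. cmod (c n) * \<rho> ^ n)"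
    and F: "\<And>z. z \<in> K \<Longrightarrow> (\<lambda>n. c n * u z ^ n) sums F z"
  shows "F \<in> clo"
proof (rule clo_limit)
  fix \<epsilon> :: real assume "\<epsilon> > 0"
  have "uniform_limit K (\<lambda>n z. \<Sum>i<n. c i * u z ^ i) (\<lambda>z. \<Sum>i. c i * u z ^ i) sequentially"
    by (rule Weierstrass_m_test[OF _ sm])
       (simp add: norm_mult norm_power mult_left_mono power_mono u(2))
  then have "\<forall>\<^sub>F n in sequentially. \<forall>z\<in>K. dist (\<Sum>i<n. c i * u z ^ i) (\<Sum>i. c i * u z ^ i) < \<epsilon>"
    using \<open>\<epsilon> > 0\<close> by (rule uniform_limitD)
  then obtain n where n: "\<forall>z\<in>K. dist (\<Sum>i<n. c i * u z ^ i) (\<Sum>i. c i * u z ^ i) < \<epsilon>"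
    using eventually_happens'[OF sequentially_bot] by blast
  have "\<forall>z\<in>K. cmod (F z - (\<Sum>i<n. c i * u z ^ i)) < \<epsilon>"
    using n F by (auto simp: dist_norm norm_minus_commute sums_iff)
  moreover have "(\<lambda>z. \<Sum>i<n. c i * u z ^ i) \<in> clo"
    by (intro clo_sum clo_cmult clo_power u)
  ultimately show "\<exists>g\<in>clo. \<forall>z\<in>K. cmod (F z - g z) < \<epsilon>" by (rule bexI)
qed

lemma clo_exp:
  assumes "u \<in> clo"
  shows "(\<lambda>z. exp (u z)) \<in> clo"
proof -
  obtain M where M: "M > 0" "\<And>z. z \<in> K \<Longrightarrow> cmod (u z) \<le> M" using clo_bounded[OF assms] by auto
  have "summable (\<lambda>n. cmod (1 / fact n) * M ^ n)"
    using summable_exp[of M] by (simp add: norm_divide inverse_eq_divide)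
  moreover have "(\<lambda>n. 1 / fact n * u z ^ n) sums exp (u z)" for z
    using exp_converges[of "u z"] by (simp add: scaleR_conv_of_real field_simps)
  ultimately show ?thesis
    by (intro clo_power_series[OF assms M(2), where c = "\<lambda>n. 1 / fact n"])
qed

lemma clo_geometric:
  assumes "u \<in> clo" "\<And>z. z \<in> K \<Longrightarrow> cmod (u z) \<le> 1/2"
  shows "(\<lambda>z. 1 / (1 - u z)) \<in> clo"
proof (rule clo_power_series[OF assms])
  show "summable (\<lambda>n. cmod ((\<lambda>_. 1) n) * (1/2) ^ n)" by (simp add: summable_geometric)
  show "(\<lambda>n. 1 * u z ^ n) sums (1 / (1 - u z))" if "z \<in> K" for z
    using geometric_sums[of "u z"] assms(2)[OF that] by simp
qed

lemma clo_Ln: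
  assumes "u \<in> clo" "\<And>z. z \<in> K \<Longrightarrow> cmod (u z) \<le> 1/2"
  shows "(\<lambda>z. Ln (1 + u z)) \<in> clo"
proof (rule clo_power_series[OF assms])
  \<comment> \<open>At \<open>n = 0\<close> division by zero gives the coefficient \<open>0\<close>,
    as the logarithmic series requires.\<close>
  let ?c = "\<lambda>n::nat. (-1)^Suc n / of_nat n :: complex"
  show "summable (\<lambda>n. cmod (?c n) * (1/2) ^ n)"
  proof (rule summable_comparison_test')
    show "summable (\<lambda>n. (1/2)^n :: real)" by (simp add: summable_geometric)
    show "norm (cmod (?c n) * (1/2) ^ n) \<le> (1/2)^n" for n
      by (cases "n = 0") (auto simp: norm_divide norm_mult norm_power field_simps)
  qed
  show "(\<lambda>n. ?c n * u z ^ n) sums Ln (1 + u z)" if "z \<in> K" for z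
    using Ln_series[of "u z"] assms(2)[OF that] by simp
qed

end

section \<open>Moving poles, and a substitute for the Cauchy kernel\<close>

context uniform_algebra
begin

text \<open>Factor \<open>1 / (z - b)\<close> as \<open>1 / (z - a)\<close> times
  \<open>1 / (1 - u z)\<close> with \<open>u z = (b - a) / (z - a)\<close>; the distance hypothesis
  makes the geometric series in \<open>u\<close> converge uniformly.\<close>

lemma clo_translate_pole:
  assumes "(\<lambda>z. 1 / (z - a)) \<in> clo"
    and "\<And>z. z \<in> K \<Longrightarrow> z \<noteq> a" "\<And>z. z \<in> K \<Longrightarrow> 2 * cmod (b - a) \<le> cmod (z - a)"
  shows "(\<lambda>z. 1 / (z - b)) \<in> clo"
proof -
  define u where "u = (\<lambda>z. (b - a) * (1 / (z - a)))"
  have "cmod (u z) \<le> 1/2" if "z \<in> K" for z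
    using assms(2,3)[OF that] by (simp add: u_def norm_divide norm_mult divide_simps)
  then have "(\<lambda>z. 1 / (1 - u z)) \<in> clo"
    using clo_cmult[OF assms(1), of "b - a"] by (intro clo_geometric) (auto simp: u_def)
  then have "(\<lambda>z. 1 / (z - a) * (1 / (1 - u z))) \<in> clo"
    by (rule clo_mult[OF assms(1)])
  then show ?thesis
  proof (rule clo_cong)
    fix z assume "z \<in> K"
    then have nz: "z - a \<noteq> 0" using assms(2) by auto
    have "(z - a) * (1 - u z) = z - b" using nz by (simp add: u_def field_simps)
    then show "1 / (z - a) * (1 / (1 - u z)) = 1 / (z - b)" by (metis mult_1 times_divide_times_eq)
  qed
qed

text \<open>Pole pushing as in Runge's theorem: whether \<open>1 / (z - a)\<close> lies in
  \<open>clo\<close> is locally constant in \<open>a\<close> off \<open>K\<close>, hence constant on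
  the connected set \<open>C\<close>.\<close>

lemma clo_push_pole:
  assumes K: "compact K" and C: "connected C" "C \<inter> K = {}" "a \<in> C" "b \<in> C"
    and a: "(\<lambda>z. 1 / (z - a)) \<in> clo"
  shows "(\<lambda>z. 1 / (z - b)) \<in> clo"
proof -
  define R where "R = (\<lambda>a b. (\<lambda>z. 1 / (z - a)) \<in> clo \<longleftrightarrow> (\<lambda>z. 1 / (z - b)) \<in> clo)"
  have "R a b"
  proof (rule connected_equivalence_relation[OF C(1,3,4)])
    fix x assume x: "x \<in> C"
    then have "x \<in> - K" using C by auto
    moreover have "open (- K)" using K by (simp add: compact_imp_closed open_Compl)
    ultimately obtain d where d: "d > 0" "ball x d \<subseteq> - K" using open_contains_ball by blast
    \<comment> \<open>With radius \<open>d/3\<close>, both \<open>x\<close> and \<open>y\<close>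
      keep distance at least \<open>2*d/3\<close> from \<open>K\<close>, so the pole can be
      translated in either direction.\<close>
    have "R x y" if "y \<in> ball x (d/3)" for y
    proof -
      have *: "cmod (z - x) \<ge> d" "cmod (z - y) \<ge> 2*d/3" if "z \<in> K" for z
      proof -
        show 1: "cmod (z - x) \<ge> d"
          using d that by (force simp: dist_norm norm_minus_commute)
        have "cmod (z - x) \<le> cmod (z - y) + cmod (y - x)"
          using norm_triangle_ineq[of "z - y" "y - x"] by simp
        then show "cmod (z - y) \<ge> 2*d/3"
          using 1 \<open>y \<in> ball x (d/3)\<close> by (simp add: dist_norm norm_minus_commute)
      qed
      have yx: "cmod (y - x) < d/3" using that by (simp add: dist_norm norm_minus_commute)
      have 1: "(\<lambda>z. 1 / (z - y)) \<in> clo" if "(\<lambda>z. 1 / (z - x)) \<in> clo"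
        by (rule clo_translate_pole[OF that]) (use * yx d in force)+
      have 2: "(\<lambda>z. 1 / (z - x)) \<in> clo" if "(\<lambda>z. 1 / (z - y)) \<in> clo"
        by (rule clo_translate_pole[OF that]) (use * yx d in \<open>force simp: norm_minus_commute\<close>)+
      show ?thesis using 1 2 by (auto simp: R_def)
    qed
    then show "\<exists>T. openin (top_of_set C) T \<and> x \<in> T \<and> (\<forall>y\<in>T. R x y)"
      using x d(1) by (intro exI[of _ "C \<inter> ball x (d/3)"]) (auto simp: openin_open_Int)
  qed (auto simp: R_def)
  then show ?thesis using a by (simp add: R_def)
qed

lemma clo_all_poles:
  assumes K: "compact K"
    and "\<And>C. C \<in> components (- K) \<Longrightarrow> \<exists>p\<in>C. (\<lambda>z. 1 / (z - p)) \<in> clo"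
    and "\<zeta> \<notin> K"
  shows "(\<lambda>z. 1 / (z - \<zeta>)) \<in> clo"
proof -
  let ?C = "connected_component_set (- K) \<zeta>"
  have C: "?C \<in> components (- K)" using assms(3) by (simp add: componentsI)
  then obtain p where p: "p \<in> ?C" "(\<lambda>z. 1 / (z - p)) \<in> clo" using assms(2) by blast
  have "?C \<inter> K = {}" using connected_component_subset[of "- K" \<zeta>] by blast
  moreover have "\<zeta> \<in> ?C" using assms(3) by simp
  ultimately show ?thesis
    using clo_push_pole[OF K connected_connected_component] p by blast
qed

text \<open>A pole going to infinity yields the identity: \<open>z\<close> differs from
  \<open>-\<zeta> - \<zeta>\<^sup>2 / (z - \<zeta>)\<close> by exactly
  \<open>z\<^sup>2 / (z - \<zeta>)\<close>, which is uniformly small on \<open>K\<close> for large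
  \<open>\<zeta>\<close>.\<close>

lemma clo_id:
  assumes K: "bounded K" and poles: "\<And>\<zeta>. \<zeta> \<notin> K \<Longrightarrow> (\<lambda>z. 1 / (z - \<zeta>)) \<in> clo"
  shows "(\<lambda>z. z) \<in> clo"
proof (rule clo_limit)
  fix \<epsilon> :: real assume e: "\<epsilon> > 0"
  obtain M where M: "M > 0" "\<And>z. z \<in> K \<Longrightarrow> cmod z \<le> M" using K unfolding bounded_pos by auto
  define t where "t = M + M^2 / \<epsilon> + 1"
  define \<zeta> :: complex where "\<zeta> = of_real t"
  have t: "t > M" "M^2 / (t - M) < \<epsilon>" using e M by (auto simp: t_def field_simps add_pos_pos)
  have "cmod \<zeta> = t" using t M by (simp add: \<zeta>_def)
  then have "\<zeta> \<notin> K" using M t by force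
  then have "(\<lambda>z. -\<zeta> - \<zeta>^2 * (1 / (z - \<zeta>))) \<in> clo"
    by (intro clo_diff clo_const clo_cmult poles)
  moreover have "cmod (z - (-\<zeta> - \<zeta>^2 * (1 / (z - \<zeta>)))) < \<epsilon>" if z: "z \<in> K" for z
  proof -
    have nz: "z - \<zeta> \<noteq> 0" using z \<open>\<zeta> \<notin> K\<close> by auto
    then have "z - (-\<zeta> - \<zeta>^2 * (1 / (z - \<zeta>))) = z^2 / (z - \<zeta>)"
      by (simp add: field_simps power2_eq_square)
    also have "cmod \<dots> = cmod z ^2 / cmod (z - \<zeta>)" by (simp add: norm_divide norm_power)
    also have "\<dots> \<le> M^2 / (t - M)"
    proof (rule frac_le)
      show "cmod z ^2 \<le> M^2" using M(2)[OF z] by (intro power_mono) auto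
      show "t - M \<le> cmod (z - \<zeta>)"
        using M(2)[OF z] \<open>cmod \<zeta> = t\<close> norm_triangle_ineq2[of \<zeta> z] by (simp add: norm_minus_commute)
    qed (use t in auto)
    finally show ?thesis using t by simp
  qed
  ultimately show "\<exists>g\<in>clo. \<forall>z\<in>K. cmod (z - g z) < \<epsilon>" by (intro bexI) auto
qed

text \<open>The last conclusion pins down the branch: far from \<open>E\<close> it has to be the principal one.\<close>

lemma clo_log_ratio:
  assumes K: "compact K" and poles: "\<And>\<zeta>. \<zeta> \<notin> K \<Longrightarrow> (\<lambda>z. 1 / (z - \<zeta>)) \<in> clo"
    and E: "connected E" "E \<inter> K = {}" "E \<subseteq> cball q r" "a \<in> E" "b \<in> E" and r: "r > 0"
  obtains L where "L \<in> clo" "\<And>z. z \<in> K \<Longrightarrow> exp (L z) = (z - b) / (z - a)"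
    "\<And>z. z \<in> K \<Longrightarrow> cmod (z - q) \<ge> 7/2 * r \<Longrightarrow> L z = Ln ((z - b) / (z - a))"
proof -
  \<comment> \<open>An equivalence relation in the endpoints: symmetric by negating
    \<open>L\<close>, transitive by adding branches, and valid locally by a power series.
    Connectedness of \<open>E\<close> then gives it for \<open>a\<close> and
    \<open>b\<close>.\<close>
  define R where "R = (\<lambda>a b. \<exists>L\<in>clo. \<forall>z\<in>K. exp (L z) = (z - b) / (z - a) \<and>
      (cmod (z - q) \<ge> 7/2 * r \<longrightarrow> L z = Ln ((z - b) / (z - a))))"
  \<comment> \<open>Far out, \<open>cmod (z - x)\<close> is at least \<open>5/2 * r\<close> while
    \<open>x\<close> and \<open>y\<close> are at most \<open>2 * r\<close> apart, so the quotient
    lies in the open unit disc about \<open>1\<close>. On the right half plane the principal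
    logarithm respects inverses and products, which symmetry and transitivity need.\<close>
  have Re_pos: "Re ((z - y) / (z - x)) > 0"
    if "x \<in> E" "y \<in> E" "cmod (z - q) \<ge> 7/2 * r" for x y z
  proof -
    have "cmod (q - x) \<le> r" "cmod (q - y) \<le> r" using that E by (auto simp: dist_norm)
    moreover have "cmod (z - q) \<le> cmod (z - x) + cmod (q - x)"
      using norm_triangle_ineq4[of "z - x" "q - x"] by simp
    moreover have "cmod (x - y) \<le> cmod (q - x) + cmod (q - y)"
      using norm_triangle_ineq4[of "q - y" "q - x"] by simp
    ultimately have *: "cmod (x - y) < cmod (z - x)" using that r by linarith
    then have "z - x \<noteq> 0" by auto
    then have "(z - y) / (z - x) = 1 + (x - y) / (z - x)" by (simp add: field_simps)
    moreover have "cmod ((x - y) / (z - x)) < 1" using * \<open>z - x \<noteq> 0\<close>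
      by (simp add: norm_divide)
    ultimately show ?thesis
      using abs_Re_le_cmod[of "(x - y) / (z - x)"] by simp
  qed
  have "R a b"
  proof (rule connected_equivalence_relation[OF E(1,4,5)])
    fix x y assume R: "R x y" and xy: "x \<in> E" "y \<in> E"
    then obtain L where L: "L \<in> clo" "\<forall>z\<in>K. exp (L z) = (z - y) / (z - x) \<and>
      (cmod (z - q) \<ge> 7/2 * r \<longrightarrow> L z = Ln ((z - y) / (z - x)))" by (auto simp: R_def)
    have "exp (- L z) = (z - x) / (z - y) \<and>
      (cmod (z - q) \<ge> 7/2 * r \<longrightarrow> - L z = Ln ((z - x) / (z - y)))" if z: "z \<in> K" for z
    proof
      show "exp (- L z) = (z - x) / (z - y)" using L z by (simp add: exp_minus)
      show "cmod (z - q) \<ge> 7/2 * r \<longrightarrow> - L z = Ln ((z - x) / (z - y))"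
      proof
        assume far: "cmod (z - q) \<ge> 7/2 * r"
        have "(z - y) / (z - x) \<notin> \<real>\<^sub>\<le>\<^sub>0"
          using Re_pos[OF xy far] by (auto simp: complex_nonpos_Reals_iff)
        then have "Ln (inverse ((z - y) / (z - x))) = - Ln ((z - y) / (z - x))"
          by (rule Ln_inverse)
        then show "- L z = Ln ((z - x) / (z - y))" using L z far by simp
      qed
    qed
    then show "R y x" unfolding R_def by (intro bexI[OF _ clo_uminus[OF L(1)]]) auto
  next
    fix x y w assume R: "R x y" "R y w" and xy: "x \<in> E" "y \<in> E" "w \<in> E"
    obtain L where L: "L \<in> clo" "\<forall>z\<in>K. exp (L z) = (z - y) / (z - x) \<and>
      (cmod (z - q) \<ge> 7/2 * r \<longrightarrow> L z = Ln ((z - y) / (z - x)))" using R by (auto simp: R_def)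
    obtain M where M: "M \<in> clo" "\<forall>z\<in>K. exp (M z) = (z - w) / (z - y) \<and>
      (cmod (z - q) \<ge> 7/2 * r \<longrightarrow> M z = Ln ((z - w) / (z - y)))" using R by (auto simp: R_def)
    have "exp (L z + M z) = (z - w) / (z - x) \<and>
      (cmod (z - q) \<ge> 7/2 * r \<longrightarrow> L z + M z = Ln ((z - w) / (z - x)))" if z: "z \<in> K" for z
    proof
      have nz: "z - y \<noteq> 0" "z - x \<noteq> 0" "z - w \<noteq> 0" using E xy z by auto
      have prod: "(z - y) / (z - x) * ((z - w) / (z - y)) = (z - w) / (z - x)"
        using nz by simp
      then show "exp (L z + M z) = (z - w) / (z - x)" using L M z by (simp add: exp_add)
      show "cmod (z - q) \<ge> 7/2 * r \<longrightarrow> L z + M z = Ln ((z - w) / (z - x))"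
      proof
        assume far: "cmod (z - q) \<ge> 7/2 * r"
        define s t where "s = (z - y) / (z - x)" and "t = (z - w) / (z - y)"
        have nz': "s \<noteq> 0" "t \<noteq> 0" using nz by (auto simp: s_def t_def)
        have "Re s > 0" "Re t > 0" using Re_pos xy far by (auto simp: s_def t_def)
        then have "\<bar>Im (Ln s)\<bar> < pi/2" "\<bar>Im (Ln t)\<bar> < pi/2"
          using nz' Re_Ln_pos_lt by blast+
        then have "Ln (s * t) = Ln s + Ln t" using nz' by (intro Ln_times_simple) auto
        then show "L z + M z = Ln ((z - w) / (z - x))"
          using L M z far prod by (simp add: s_def t_def)
      qed
    qed
    then show "R x w" unfolding R_def by (intro bexI[OF _ clo_add[OF L(1) M(1)]]) auto
  next
    fix x assume x: "x \<in> E"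
    then have "x \<in> - K" using E by auto
    moreover have "open (- K)" using K by (simp add: compact_imp_closed open_Compl)
    ultimately obtain d where d: "d > 0" "ball x d \<subseteq> - K" using open_contains_ball by blast
    \<comment> \<open>For \<open>y\<close> this close to \<open>x\<close> the quotient is
      \<open>1 + u z\<close> with \<open>cmod (u z) \<le> 1/2\<close> on all of \<open>K\<close>, so
      the principal branch serves both near and far.\<close>
    have "R x y" if y: "y \<in> ball x (d/2)" for y
    proof -
      have far: "cmod (z - x) \<ge> d" if "z \<in> K" for z
        using d that by (force simp: dist_norm norm_minus_commute)
      have yx: "cmod (x - y) < d/2" using y by (simp add: dist_norm)
      define u where "u = (\<lambda>z. (x - y) * (1 / (z - x)))"
      have nz: "z - x \<noteq> 0" if "z \<in> K" for z using far[OF that] d by auto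
      have u_le: "cmod (u z) \<le> 1/2" if "z \<in> K" for z
      proof -
        have "cmod (u z) = cmod (x - y) / cmod (z - x)" by (simp add: u_def norm_divide norm_mult)
        also have "\<dots> \<le> (d/2) / d" using far[OF that] yx d by (intro frac_le) auto
        finally show ?thesis using d by simp
      qed
      have "(\<lambda>z. Ln (1 + u z)) \<in> clo"
        using \<open>x \<in> - K\<close> u_le unfolding u_def by (intro clo_Ln clo_cmult poles) auto
      moreover have u_eq: "1 + u z = (z - y) / (z - x)" if "z \<in> K" for z
        using nz[OF that] by (simp add: u_def field_simps)
      moreover have "1 + u z \<noteq> 0" if "z \<in> K" for z
      proof
        assume "1 + u z = 0"
        then have "u z = -1" by (simp add: add_eq_0_iff)
        then show False using u_le[OF that] by simp
      qed
      ultimately show ?thesis unfolding R_def by (intro bexI[where x = "\<lambda>z. Ln (1 + u z)"]) auto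
    qed
    then show "\<exists>T. openin (top_of_set E) T \<and> x \<in> T \<and> (\<forall>y\<in>T. R x y)"
      using x d(1) by (intro exI[of _ "E \<inter> ball x (d/2)"]) (auto simp: openin_open_Int)
  qed
  then show thesis using that unfolding R_def by blast
qed

text \<open>This replaces the usual appeal to the Riemann mapping theorem and Koebe's quarter theorem.\<close>

lemma clo_kernel:
  assumes K: "compact K" and poles: "\<And>\<zeta>. \<zeta> \<notin> K \<Longrightarrow> (\<lambda>z. 1 / (z - \<zeta>)) \<in> clo"
    and U: "open U" "connected U" "U \<inter> K = {}" "q \<in> U" "u \<in> U"
    and r: "r > 0" "dist q u > r"
  obtains g c where "g \<in> clo" "cmod (c - q) \<le> r" "\<And>z. z \<in> K \<Longrightarrow> cmod (g z) \<le> 72 / r"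
    "\<And>z. z \<in> K \<Longrightarrow> 4 * r \<le> cmod (z - c) \<Longrightarrow>
       cmod (g z - 1 / (z - c)) \<le> r\<^sup>2 / cmod (z - c) ^ 3"
proof -
  have "path_connected U" using U by (simp add: connected_open_path_connected)
  then obtain \<gamma> where \<gamma>: "path \<gamma>" "path_image \<gamma> \<subseteq> U" "pathstart \<gamma> = q" "pathfinish \<gamma> = u"
    using U unfolding path_connected_def by blast
  \<comment> \<open>The path has to leave the disc because \<open>dist q u > r\<close>. Cutting it
    where it reaches the circle keeps \<open>E\<close> inside \<open>cball q r\<close> and gives
    \<open>cmod (b - q) = r\<close>.\<close>
  obtain \<gamma>' where \<gamma>': "path \<gamma>'" "pathstart \<gamma>' = q" "path_image \<gamma>' \<subseteq> path_image \<gamma> \<inter> cball q r"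
      "pathfinish \<gamma>' \<in> frontier (cball q r)"
    using exists_path_subpath_to_frontier_closed[of "cball q r" \<gamma>] \<gamma> r by auto
  define E where "E = path_image \<gamma>'"
  define b where "b = pathfinish \<gamma>'"
  have "cmod (b - q) = r"
    using \<gamma>'(4) r by (auto simp: b_def dist_norm norm_minus_commute)
  have "connected E" "E \<inter> K = {}" "E \<subseteq> cball q r" "q \<in> E" "b \<in> E"
    using \<gamma>' \<gamma>(2) U(3) pathstart_in_path_image[of \<gamma>'] pathfinish_in_path_image[of \<gamma>']
    by (auto simp: E_def b_def connected_path_image)
  then obtain L where L: "L \<in> clo" "\<And>z. z \<in> K \<Longrightarrow> exp (L z) = (z - b) / (z - q)"
    "\<And>z. z \<in> K \<Longrightarrow> cmod (z - q) \<ge> 7/2 * r \<Longrightarrow> L z = Ln ((z - b) / (z - q))"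
    using clo_log_ratio[OF K poles] r(1) by metis
  define c d where "c = (q + b) / 2" and "d = (b - q) / 2"
  define w h where "w = (\<lambda>z. z - c)" and "h = (\<lambda>z. (z - q) * exp (1/2 * L z))"
  \<comment> \<open>On \<open>K\<close>, \<open>h\<close> squared is
    \<open>(z - q) * (z - b)\<close>, that is \<open>w\<close> squared minus \<open>d\<close>
    squared, so \<open>g = 2 / (w + h)\<close>. Far out \<open>h\<close> behaves like
    \<open>w\<close>, and centring at the midpoint \<open>c\<close> removes the term of order
    \<open>1 / w\<^sup>2\<close> from \<open>g\<close>.\<close>
  define g where "g = (\<lambda>z. (2 / d\<^sup>2) * (w z - h z))"
  have d: "cmod d = r / 2" using \<open>cmod (b - q) = r\<close> by (simp add: d_def norm_divide)
  then have "d \<noteq> 0" using r by auto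
  have cq: "c - q = d" "b - c = d" by (simp_all add: c_def d_def field_simps)
  have nz: "z - q \<noteq> 0" if "z \<in> K" for z using U that by auto
  have h2: "(h z)\<^sup>2 = (z - q) * (z - b)" if "z \<in> K" for z
  proof -
    have "(exp (1/2 * L z))\<^sup>2 = exp (L z)" by (simp add: power2_eq_square flip: exp_add)
    then show ?thesis using L(2)[OF that] nz[OF that]
      by (simp add: h_def power_mult_distrib) (simp add: power2_eq_square)
  qed
  have wh: "(w z - h z) * (w z + h z) = d\<^sup>2" if "z \<in> K" for z
  proof -
    have "(w z - h z) * (w z + h z) = (w z)\<^sup>2 - (h z)\<^sup>2" by (simp add: algebra_simps power2_eq_square)
    also have "\<dots> = (w z)\<^sup>2 - (z - q) * (z - b)" by (simp add: h2[OF that])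
    also have "\<dots> = d\<^sup>2" by (simp add: w_def c_def d_def power2_eq_square field_simps)
    finally show ?thesis .
  qed
  \<comment> \<open>The branch of \<open>L\<close> enters here: the condition about \<open>c\<close>
    gives distance at least \<open>7/2 * r\<close> from \<open>q\<close>, so
    \<open>exp (1/2 * L z)\<close> is the principal root and \<open>h\<close> cannot cancel
    \<open>w\<close>.\<close>
  have far: "cmod (w z) \<le> cmod (w z + h z)" if z: "z \<in> K" "4 * r \<le> cmod (w z)" for z
  proof -
    define x where "x = (z - b) / (z - q)"
    define s where "s = csqrt x"
    have "cmod (z - c) \<le> cmod (z - q) + cmod (c - q)"
      using norm_triangle_ineq4[of "z - q" "c - q"] by simp
    then have "cmod (z - q) \<ge> 7/2 * r" using z d r by (simp add: w_def cq)
    then have "L z = Ln x" using L(3) z x_def by simp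
    moreover have "x \<noteq> 0" using L(2)[OF z(1)] exp_not_eq_zero[of "L z"] by (simp add: x_def)
    ultimately have "exp (1/2 * L z) = s" by (simp add: s_def csqrt_exp_Ln)
    then have h: "h z = (z - q) * s" by (simp add: h_def)
    \<comment> \<open>With \<open>s\<^sup>2 = x\<close>, both \<open>w + h\<close> and \<open>w\<close> are \<open>z - q\<close> times a polynomial in \<open>s\<close>, and \<open>Re s \<ge> 0\<close>.\<close>
    have s2: "s\<^sup>2 = x" by (simp add: s_def)
    have "(z - q) * s\<^sup>2 = z - b" using nz[OF z(1)] by (simp add: s2 x_def)
    then have w: "w z = (z - q) * (1 + s\<^sup>2) / 2"
      by (simp add: w_def c_def distrib_left) (simp add: field_simps)
    have wph: "w z + h z = (z - q) * (1 + s)\<^sup>2 / 2"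
      by (simp add: w h field_simps power2_eq_square)
    have "cmod (1 + s\<^sup>2) \<le> cmod (1 + s) ^ 2"
    proof -
      have "Re s \<ge> 0" using csqrt_principal[of x] by (auto simp: s_def)
      then have "1 + cmod s ^ 2 \<le> cmod (1 + s) ^ 2"
        by (simp add: cmod_power2) (simp add: power2_eq_square algebra_simps)
      moreover have "cmod (1 + s\<^sup>2) \<le> 1 + cmod s ^ 2"
        using norm_triangle_ineq[of 1 "s\<^sup>2"] by (simp add: norm_power)
      ultimately show ?thesis by linarith
    qed
    then show ?thesis
      unfolding wph unfolding w by (simp add: norm_mult norm_divide norm_power mult_left_mono)
  qed
  have id: "(\<lambda>z. z) \<in> clo" using clo_id[OF compact_imp_bounded[OF K] poles] .
  have "(\<lambda>z. exp (1/2 * L z)) \<in> clo" by (rule clo_exp[OF clo_cmult[OF L(1)]])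
  then have "g \<in> clo" unfolding g_def w_def h_def
    by (intro clo_cmult clo_diff clo_mult id clo_const)
  moreover have "cmod (c - q) \<le> r" using d r by (simp add: cq)
  moreover have gfar: "g z * (w z + h z) = 2" if "z \<in> K" for z
    unfolding g_def mult.assoc wh[OF that] using \<open>d \<noteq> 0\<close> by simp
  have "cmod (g z) \<le> 72 / r" if z: "z \<in> K" for z
  proof (cases "4 * r \<le> cmod (w z)")
    case True
    then have "4 * r \<le> cmod (w z + h z)" using far[OF z] by simp
    moreover have "cmod (g z) * cmod (w z + h z) = 2"
      by (metis gfar[OF z] norm_mult norm_numeral)
    ultimately have "cmod (g z) * (4 * r) \<le> 2"
      by (metis mult_left_mono norm_ge_zero)
    then show ?thesis using r by (simp add: field_simps)
  next
    case False
    then have w: "cmod (w z) \<le> 4 * r" by simp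
    have "z - q = w z + d" "z - b = w z - d" using cq by (auto simp: w_def algebra_simps)
    \<comment> \<open>Since \<open>cmod d = r/2\<close>, each factor of \<open>h\<close> squared is
      at most \<open>4 * r + r/2\<close>. Hence \<open>w - h\<close> is at most
      \<open>9 * r\<close>, and multiplying by \<open>2 / (r/2)\<^sup>2\<close> gives
      \<open>72 / r\<close>.\<close>
    then have "cmod (z - q) \<le> 9/2 * r" "cmod (z - b) \<le> 9/2 * r"
      using norm_triangle_ineq[of "w z" d] norm_triangle_ineq4[of "w z" d] w d by auto
    then have "cmod (z - q) * cmod (z - b) \<le> (9/2 * r) * (9/2 * r)"
      using r by (intro mult_mono) auto
    moreover have "cmod (h z) ^ 2 = cmod (z - q) * cmod (z - b)"
      by (metis h2[OF z] norm_power norm_mult)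
    ultimately have "cmod (h z) ^ 2 \<le> (9/2 * r)\<^sup>2" by (simp add: power2_eq_square)
    then have "cmod (h z) \<le> 9/2 * r" by (rule power2_le_imp_le) (use r in auto)
    then have "cmod (w z - h z) \<le> 9 * r"
      using norm_triangle_ineq4[of "w z" "h z"] w r by linarith
    then have "cmod (g z) \<le> 2 / (r/2)\<^sup>2 * (9 * r)"
      unfolding g_def norm_mult norm_divide norm_power d by (simp add: mult_left_mono divide_right_mono)
    also have "\<dots> = 72 / r" using r by (simp add: power2_eq_square)
    finally show ?thesis .
  qed
  moreover have "cmod (g z - 1 / (z - c)) \<le> r\<^sup>2 / cmod (z - c) ^ 3"
    if z: "z \<in> K" "4 * r \<le> cmod (z - c)" for z
  proof -
    have f: "cmod (w z) \<le> cmod (w z + h z)" using far z by (simp add: w_def)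
    have pos: "cmod (w z) > 0" using z(2) r(1) unfolding w_def by linarith
    then have nz: "w z \<noteq> 0" "w z + h z \<noteq> 0" using f by auto
    have gz: "g z = 2 / (w z + h z)" using gfar[OF z(1)] nz by (simp add: eq_divide_eq)
    \<comment> \<open>Used with \<open>u = w z\<close> and \<open>p = w z + h z\<close>: the
      numerator becomes \<open>(w z - h z) * (w z + h z)\<close>, which is the constant
      \<open>d\<^sup>2\<close>, and the denominator grows like the cube of
      \<open>w z\<close>.\<close>
    have "2 / p - 1 / u = (u - (p - u)) * p / (u * p\<^sup>2)" if "u \<noteq> 0" "p \<noteq> 0" for u p :: complex
      using that by (simp add: divide_simps power2_eq_square)
    from this[OF nz] have "g z - 1 / w z = (w z - h z) * (w z + h z) / (w z * (w z + h z)\<^sup>2)"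
      by (simp add: gz)
    also have "\<dots> = d\<^sup>2 / (w z * (w z + h z)\<^sup>2)" by (simp add: wh[OF z(1)])
    also have "cmod \<dots> = (r/2)\<^sup>2 / (cmod (w z) * cmod (w z + h z) ^ 2)"
      by (simp add: norm_divide norm_mult norm_power d)
    also have "\<dots> \<le> r\<^sup>2 / (cmod (w z) * cmod (w z) ^ 2)"
      using f pos r by (intro frac_le mult_left_mono power_mono) (auto simp: power2_eq_square)
    finally show ?thesis by (simp add: w_def power3_eq_cube power2_eq_square mult.assoc)
  qed
  ultimately show thesis using that by blast
qed

end

section \<open>Cauchy integrals over grid cells\<close>

lemma rectpath_integrable:
  assumes "continuous_on (path_image (rectpath a b)) h"
  shows "h contour_integrable_on (rectpath a b)"
proof -
  define c d where "c = Complex (Re b) (Im a)" and "d = Complex (Re a) (Im b)"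
  have "path_image (rectpath a b) = closed_segment a c \<union> closed_segment c b \<union> closed_segment b d \<union> closed_segment d a"
    by (simp add: rectpath_def Let_def path_image_join Un_assoc c_def d_def)
  then have "h contour_integrable_on linepath a c" "h contour_integrable_on linepath c b"
     "h contour_integrable_on linepath b d" "h contour_integrable_on linepath d a"
    using assms by (auto intro!: contour_integrable_continuous_linepath intro: continuous_on_subset)
  then show ?thesis by (simp add: rectpath_def Let_def c_def d_def)
qed

text \<open>Opposite sides are oriented in the same direction, so an edge shared by two neighbouring
  cells contributes the same integral with opposite signs.\<close>

lemma rectpath_integral_expand:
  fixes a b :: complex
  defines "c \<equiv> Complex (Re b) (Im a)" and "d \<equiv> Complex (Re a) (Im b)"
  assumes "continuous_on (path_image (rectpath a b)) h"
  shows "contour_integral (rectpath a b) h =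
    contour_integral (linepath a c) h + contour_integral (linepath c b) h
     - contour_integral (linepath d b) h - contour_integral (linepath a d) h"
proof -
  have pi: "path_image (rectpath a b) = closed_segment a c \<union> closed_segment c b \<union> closed_segment b d \<union> closed_segment d a"
    by (simp add: rectpath_def Let_def path_image_join Un_assoc c_def d_def)
  then have *: "h contour_integrable_on linepath a c" "h contour_integrable_on linepath c b"
     "h contour_integrable_on linepath b d" "h contour_integrable_on linepath d a"
    using assms(3) by (auto intro!: contour_integrable_continuous_linepath intro: continuous_on_subset)
  have "contour_integral (linepath b d) h = - contour_integral (linepath d b) h"
       "contour_integral (linepath d a) h = - contour_integral (linepath a d) h"
    using assms(3) pi
    by (auto intro!: contour_integral_reverse_linepath intro: continuous_on_subset)
  then show ?thesis using * by (simp add: rectpath_def Let_def flip: c_def d_def)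
qed

lemma rectpath_integral_bound:
  assumes cont: "continuous_on (path_image (rectpath a b)) h"
    and side: "Re b = Re a + s" "Im b = Im a + s" "s \<ge> 0"
    and B: "\<And>\<zeta>. \<zeta> \<in> path_image (rectpath a b) \<Longrightarrow> cmod (h \<zeta>) \<le> B"
  shows "cmod (contour_integral (rectpath a b) h) \<le> 4 * s * B"
proof -
  define c d where "c = Complex (Re b) (Im a)" and "d = Complex (Re a) (Im b)"
  have pi: "path_image (rectpath a b) = closed_segment a c \<union> closed_segment c b \<union> closed_segment d b \<union> closed_segment a d"
    by (simp add: rectpath_def Let_def path_image_join Un_assoc c_def d_def closed_segment_commute)
  have "B \<ge> 0" using B[of a] pi norm_ge_zero order_trans by blast
  then have *: "cmod (contour_integral (linepath x y) h) \<le> B * cmod (y - x)"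
    if "closed_segment x y \<subseteq> path_image (rectpath a b)" for x y
    using that cont B
    by (intro contour_integral_bound_linepath contour_integrable_continuous_linepath)
       (auto intro: continuous_on_subset)
  have "cmod (c - a) = s" "cmod (b - c) = s" "cmod (b - d) = s" "cmod (d - a) = s"
    using side by (auto simp: c_def d_def cmod_def)
  then have "cmod (contour_integral (linepath a c) h) \<le> B * s" "cmod (contour_integral (linepath c b) h) \<le> B * s"
    "cmod (contour_integral (linepath d b) h) \<le> B * s" "cmod (contour_integral (linepath a d) h) \<le> B * s"
    using *[of a c] *[of c b] *[of d b] *[of a d] pi by auto
  moreover have "cmod (x + y - u - v) \<le> cmod x + cmod y + cmod u + cmod v" for x y u v
    using norm_triangle_ineq4[of "x + y - u" v] norm_triangle_ineq4[of "x + y" u]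
      norm_triangle_ineq[of x y] by linarith
  ultimately have "cmod (contour_integral (linepath a c) h + contour_integral (linepath c b) h
     - contour_integral (linepath d b) h - contour_integral (linepath a d) h) \<le> B * s + B * s + B * s + B * s"
    by (meson add_mono order_trans)
  then show ?thesis
    unfolding rectpath_integral_expand[OF cont] c_def[symmetric] d_def[symmetric] by (simp add: mult_ac)
qed

lemma rectpath_Cauchy:
  assumes "Re a \<le> Re b" "Im a \<le> Im b"
    and "continuous_on (cbox a b) h" "h holomorphic_on interior (cbox a b)"
  shows "contour_integral (rectpath a b) h = 0"
proof (rule contour_integral_unique, rule Cauchy_theorem_convex[where S = "cbox a b" and K = "{}"])
  show "path_image (rectpath a b) \<subseteq> cbox a b"
    using assms by (intro path_image_rectpath_subset_cbox)
  show "\<And>x. x \<in> interior (cbox a b) - {} \<Longrightarrow> h field_differentiable at x"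
    using assms(4) holomorphic_on_imp_differentiable_at by blast
qed (use assms in auto)

lemma sum_telescope_int:
  fixes F :: "int \<Rightarrow> 'a::ab_group_add"
  assumes "a \<le> b"
  shows "(\<Sum>n\<in>{a..<b}. F n - F (n + 1)) = F a - F b"
  using assms
proof (induction rule: int_ge_induct)
  case (step i)
  then have "{a..<i + 1} = insert i {a..<i}" by auto
  then show ?case using step by simp
qed auto

context
  fixes \<delta> :: real assumes \<delta>: "\<delta> > 0"
begin

definition gridpt :: "int \<Rightarrow> int \<Rightarrow> complex" where
  "gridpt m n = Complex (\<delta> * of_int m) (\<delta> * of_int n)"

lemma gridpt_simps [simp]: "Re (gridpt m n) = \<delta> * of_int m" "Im (gridpt m n) = \<delta> * of_int n"
  by (auto simp: gridpt_def)

lemma sum_horizontal: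
  assumes h: "continuous_on UNIV h" and "a \<le> b"
  shows "(\<Sum>m\<in>{a..<b}. contour_integral (linepath (gridpt m n) (gridpt (m + 1) n)) h)
       = contour_integral (linepath (gridpt a n) (gridpt b n)) h"
  using assms(2)
proof (induction rule: int_ge_induct)
  case (step i)
  then have "{a..<i + 1} = insert i {a..<i}" by auto
  moreover have "gridpt i n \<in> closed_segment (gridpt a n) (gridpt (i + 1) n)"
    using step \<delta> by (simp add: closed_segment_same_Im closed_segment_eq_real_ivl)
  ultimately show ?case
    using step contour_integral_split_linepath[of "gridpt a n" "gridpt (i + 1) n" h "gridpt i n"]
      continuous_on_subset[OF h] by simp
qed (simp only: contour_integral_trivial atLeastLessThan_empty order_refl sum.empty)

lemma sum_vertical:
  assumes h: "continuous_on UNIV h" and "a \<le> b"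
  shows "(\<Sum>n\<in>{a..<b}. contour_integral (linepath (gridpt m n) (gridpt m (n + 1))) h)
       = contour_integral (linepath (gridpt m a) (gridpt m b)) h"
  using assms(2)
proof (induction rule: int_ge_induct)
  case (step i)
  then have "{a..<i + 1} = insert i {a..<i}" by auto
  moreover have "gridpt m i \<in> closed_segment (gridpt m a) (gridpt m (i + 1))"
    using step \<delta> by (simp add: closed_segment_same_Re closed_segment_eq_real_ivl)
  ultimately show ?case
    using step contour_integral_split_linepath[of "gridpt m a" "gridpt m (i + 1)" h "gridpt m i"]
      continuous_on_subset[OF h] by simp
qed (simp only: contour_integral_trivial atLeastLessThan_empty order_refl sum.empty)

text \<open>Inner edges cancel: horizontal ones telescope in \<open>n\<close>, vertical ones in
  \<open>m\<close>, and the surviving edges add up to the sides of the large rectangle.\<close>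

lemma sum_cells:
  assumes h: "continuous_on UNIV h" and ab: "a \<le> b" "c \<le> d"
  shows "(\<Sum>m\<in>{a..<b}. \<Sum>n\<in>{c..<d}.
            contour_integral (rectpath (gridpt m n) (gridpt (m + 1) (n + 1))) h)
       = contour_integral (rectpath (gridpt a c) (gridpt b d)) h"
proof -
  define H where "H = (\<lambda>m n. contour_integral (linepath (gridpt m n) (gridpt (m + 1) n)) h)"
  define V where "V = (\<lambda>m n. contour_integral (linepath (gridpt m n) (gridpt m (n + 1))) h)"
  have corner: "Complex (\<delta> * of_int m) (\<delta> * of_int n) = gridpt m n" for m n
    by (simp add: gridpt_def)
  have cell: "contour_integral (rectpath (gridpt m n) (gridpt (m + 1) (n + 1))) h
      = (H m n - H m (n + 1)) + (V (m + 1) n - V m n)" for m n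
    using rectpath_integral_expand[of "gridpt m n" "gridpt (m + 1) (n + 1)" h]
      continuous_on_subset[OF h] unfolding gridpt_simps corner H_def V_def by simp
  have "(\<Sum>m\<in>{a..<b}. \<Sum>n\<in>{c..<d}. H m n - H m (n + 1)) = (\<Sum>m\<in>{a..<b}. H m c) - (\<Sum>m\<in>{a..<b}. H m d)"
    by (simp only: sum_telescope_int[OF ab(2), of "H _"] sum_subtractf[of _ _ "{a..<b}"])
  moreover have "(\<Sum>m\<in>{a..<b}. \<Sum>n\<in>{c..<d}. V (m + 1) n - V m n)
      = (\<Sum>n\<in>{c..<d}. V b n) - (\<Sum>n\<in>{c..<d}. V a n)"
  proof -
    have "(\<Sum>m\<in>{a..<b}. V (m + 1) n - V m n) = V b n - V a n" for n
      using sum_telescope_int[OF ab(1), of "\<lambda>m. - V m n"] by simp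
    then show ?thesis by (subst sum.swap) (simp add: sum_subtractf)
  qed
  moreover have "(\<Sum>m\<in>{a..<b}. \<Sum>n\<in>{c..<d}. (H m n - H m (n + 1)) + (V (m + 1) n - V m n))
    = (\<Sum>m\<in>{a..<b}. \<Sum>n\<in>{c..<d}. H m n - H m (n + 1)) + (\<Sum>m\<in>{a..<b}. \<Sum>n\<in>{c..<d}. V (m + 1) n - V m n)"
    by (simp only: sum.distrib)
  ultimately show ?thesis
    using rectpath_integral_expand[of "gridpt a c" "gridpt b d" h] continuous_on_subset[OF h]
      sum_horizontal[OF h ab(1)] sum_vertical[OF h ab(2)]
    unfolding gridpt_simps corner cell H_def V_def by simp
qed

end

text \<open>The first two terms of the expansion of \<open>1 / (\<zeta> - z)\<close> about
  \<open>c\<close> produce \<open>\<alpha>\<close> and \<open>\<beta>\<close> with a minus sign; the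
  remainder is of third order in \<open>1 / (z - c)\<close>. The bounds involve only the oscillation
  \<open>e\<close> of \<open>f\<close>, because a constant times a function holomorphic on the cell
  integrates to zero.\<close>

lemma cell_expansion:
  fixes f :: "complex \<Rightarrow> complex" and lo hi c z v :: complex and \<delta> e :: real
  defines "\<alpha> \<equiv> contour_integral (rectpath lo hi) f"
    and "\<beta> \<equiv> contour_integral (rectpath lo hi) (\<lambda>\<zeta>. f \<zeta> * (\<zeta> - c))"
  assumes side: "Re hi = Re lo + \<delta>" "Im hi = Im lo + \<delta>" "\<delta> > 0"
    and f: "continuous_on (cbox lo hi) f" "\<And>\<zeta>. \<zeta> \<in> cbox lo hi \<Longrightarrow> cmod (f \<zeta> - v) \<le> e"
    and c: "\<And>\<zeta>. \<zeta> \<in> cbox lo hi \<Longrightarrow> cmod (\<zeta> - c) \<le> 4 * \<delta>"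
  shows "cmod \<alpha> \<le> 4 * \<delta> * e" "cmod \<beta> \<le> 16 * \<delta>\<^sup>2 * e"
    "8 * \<delta> \<le> cmod (z - c) \<Longrightarrow>
     cmod (contour_integral (rectpath lo hi) (\<lambda>\<zeta>. f \<zeta> / (\<zeta> - z)) + (\<alpha> / (z - c) + \<beta> / (z - c)\<^sup>2))
       \<le> 128 * e * \<delta> ^ 3 / cmod (z - c) ^ 3"
proof -
  let ?I = "contour_integral (rectpath lo hi)"
  have sub: "path_image (rectpath lo hi) \<subseteq> cbox lo hi"
    using side by (intro path_image_rectpath_subset_cbox) auto
  have "lo \<in> cbox lo hi" using side by (simp add: in_cbox_complex_iff)
  then have e: "e \<ge> 0" using f(2) norm_ge_zero order_trans by blast
  have int: "h contour_integrable_on (rectpath lo hi)" if "continuous_on (cbox lo hi) h" for h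
    using rectpath_integrable continuous_on_subset[OF that sub] by blast
  have red: "?I (\<lambda>\<zeta>. f \<zeta> * k \<zeta>) = ?I (\<lambda>\<zeta>. (f \<zeta> - v) * k \<zeta>)"
    if k: "k holomorphic_on cbox lo hi" for k
  proof -
    have kc: "continuous_on (cbox lo hi) k" using k by (rule holomorphic_on_imp_continuous_on)
    have "?I k = 0"
      using k kc side by (intro rectpath_Cauchy holomorphic_on_subset[OF k] interior_subset) auto
    then have "?I (\<lambda>\<zeta>. v * k \<zeta>) = 0" by (simp add: contour_integral_lmul int kc)
    moreover have "?I (\<lambda>\<zeta>. f \<zeta> * k \<zeta> - v * k \<zeta>) = ?I (\<lambda>\<zeta>. f \<zeta> * k \<zeta>) - ?I (\<lambda>\<zeta>. v * k \<zeta>)"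
      by (intro contour_integral_diff int continuous_intros f kc)
    ultimately show ?thesis by (simp add: algebra_simps)
  qed
  have bd: "cmod (?I (\<lambda>\<zeta>. f \<zeta> * k \<zeta>)) \<le> 4 * \<delta> * (e * M)"
    if k: "k holomorphic_on cbox lo hi" "\<And>\<zeta>. \<zeta> \<in> cbox lo hi \<Longrightarrow> cmod (k \<zeta>) \<le> M" for k M
    unfolding red[OF k(1)]
  proof (rule rectpath_integral_bound[OF _ side(1,2)])
    show "continuous_on (path_image (rectpath lo hi)) (\<lambda>\<zeta>. (f \<zeta> - v) * k \<zeta>)"
      using f(1) holomorphic_on_imp_continuous_on[OF k(1)] sub
      by (intro continuous_intros) (auto intro: continuous_on_subset)
    show "cmod ((f \<zeta> - v) * k \<zeta>) \<le> e * M" if "\<zeta> \<in> path_image (rectpath lo hi)" for \<zeta>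
      using sub that f(2) k(2) e by (auto simp: norm_mult intro!: mult_mono)
  qed (use side in auto)
  show "cmod \<alpha> \<le> 4 * \<delta> * e" using bd[of "\<lambda>_. 1" 1] by (simp add: \<alpha>_def)
  have "cmod \<beta> \<le> 4 * \<delta> * (e * (4 * \<delta>))"
    unfolding \<beta>_def by (rule bd) (auto intro!: holomorphic_intros c)
  then show "cmod \<beta> \<le> 16 * \<delta>\<^sup>2 * e" by (simp add: power2_eq_square mult_ac)
  assume z: "8 * \<delta> \<le> cmod (z - c)"
  define w where "w = z - c"
  \<comment> \<open>The remainder of the Cauchy kernel; on the cell it equals
    \<open>(\<zeta> - c)\<^sup>2 / (w\<^sup>2 * (\<zeta> - z))\<close>. The factor \<open>32\<close>
    below is \<open>4\<^sup>2 * 2\<close>, the \<open>2\<close> coming from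
    \<open>cmod (\<zeta> - z) \<ge> cmod w / 2\<close>.\<close>
  define k where "k = (\<lambda>\<zeta>. 1 / (\<zeta> - z) + 1 / w + (\<zeta> - c) / w\<^sup>2)"
  have w: "w \<noteq> 0" "cmod w > 0" using z side by (auto simp: w_def)
  have dist: "cmod (\<zeta> - z) \<ge> cmod w / 2" if "\<zeta> \<in> cbox lo hi" for \<zeta>
    using norm_triangle_ineq4[of "\<zeta> - c" "\<zeta> - z"] c[OF that] z by (simp add: w_def)
  then have nz: "\<zeta> - z \<noteq> 0" if "\<zeta> \<in> cbox lo hi" for \<zeta> using w that by force
  have khol: "k holomorphic_on cbox lo hi"
    unfolding k_def using nz w by (intro holomorphic_intros) auto
  have kb: "cmod (k \<zeta>) \<le> 32 * \<delta>\<^sup>2 / cmod w ^ 3" if \<zeta>: "\<zeta> \<in> cbox lo hi" for \<zeta>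
  proof -
    have "1 / (t - w) + 1 / w + t / w\<^sup>2 = t\<^sup>2 / (w\<^sup>2 * (t - w))" if "t - w \<noteq> 0" for t
      using that w by (simp add: divide_simps) (simp add: power2_eq_square algebra_simps)
    moreover have eq: "(\<zeta> - c) - w = \<zeta> - z" by (simp add: w_def)
    ultimately have "k \<zeta> = (\<zeta> - c)\<^sup>2 / (w\<^sup>2 * (\<zeta> - z))"
      using nz[OF \<zeta>] unfolding k_def by (metis eq)
    also have "cmod \<dots> = cmod (\<zeta> - c) ^ 2 / (cmod w ^ 2 * cmod (\<zeta> - z))"
      by (simp add: norm_divide norm_mult norm_power)
    also have "\<dots> \<le> (4 * \<delta>) ^ 2 / (cmod w ^ 2 * (cmod w / 2))"
      using c[OF \<zeta>] dist[OF \<zeta>] w by (intro frac_le mult_left_mono power_mono) auto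
    also have "\<dots> = 32 * \<delta>\<^sup>2 / cmod w ^ 3"
      by (simp add: power2_eq_square power3_eq_cube)
    finally show ?thesis .
  qed
  have "?I (\<lambda>\<zeta>. f \<zeta> * k \<zeta>) = ?I (\<lambda>\<zeta>. f \<zeta> / (\<zeta> - z) + (f \<zeta> / w + (f \<zeta> * (\<zeta> - c)) / w\<^sup>2))"
    by (simp add: k_def algebra_simps)
  also have "\<dots> = ?I (\<lambda>\<zeta>. f \<zeta> / (\<zeta> - z)) + (\<alpha> / w + \<beta> / w\<^sup>2)"
    unfolding \<alpha>_def \<beta>_def
    by (subst contour_integral_add contour_integral_div
        | intro int continuous_intros f | use nz w in simp)+
  finally show "cmod (?I (\<lambda>\<zeta>. f \<zeta> / (\<zeta> - z)) + (\<alpha> / (z - c) + \<beta> / (z - c)\<^sup>2))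
       \<le> 128 * e * \<delta> ^ 3 / cmod (z - c) ^ 3"
    using bd[OF khol kb] by (simp add: w_def power2_eq_square power3_eq_cube mult_ac)
qed

text \<open>Since \<open>g\<close> equals \<open>1 / w\<close> up to third order,
  \<open>\<alpha> * g + \<beta> * g\<^sup>2\<close> reproduces both terms of the cell expansion. The
  constants are \<open>83232 = 4 * 72 + 16 * 72\<^sup>2\<close> and
  \<open>1172 = 4 + 16 * 73\<close>.\<close>

lemma kernel_combination:
  fixes \<alpha> \<beta> g w :: complex and \<delta> e :: real
  assumes "\<delta> > 0" "cmod \<alpha> \<le> 4 * \<delta> * e" "cmod \<beta> \<le> 16 * \<delta>\<^sup>2 * e" "cmod g \<le> 72 / \<delta>"
  shows "cmod (\<alpha> * g + \<beta> * g\<^sup>2) \<le> 83232 * e"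
    "8 * \<delta> \<le> cmod w \<Longrightarrow> cmod (g - 1 / w) \<le> \<delta>\<^sup>2 / cmod w ^ 3 \<Longrightarrow>
      cmod (\<alpha> * g + \<beta> * g\<^sup>2 - (\<alpha> / w + \<beta> / w\<^sup>2)) \<le> 1172 * e * \<delta> ^ 3 / cmod w ^ 3"
proof -
  have "0 \<le> 4 * \<delta> * e" using assms(2) norm_ge_zero order_trans by blast
  then have e: "e \<ge> 0" using assms(1) by (simp add: zero_le_mult_iff)
  have "cmod (\<alpha> * g + \<beta> * g\<^sup>2) \<le> cmod \<alpha> * cmod g + cmod \<beta> * cmod g ^ 2"
    using norm_triangle_ineq[of "\<alpha> * g" "\<beta> * g\<^sup>2"] by (simp add: norm_mult norm_power)
  also have "\<dots> \<le> (4 * \<delta> * e) * (72 / \<delta>) + (16 * \<delta>\<^sup>2 * e) * (72 / \<delta>) ^ 2"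
    using assms e by (intro add_mono mult_mono power_mono) auto
  also have "\<dots> = 83232 * e" using assms(1) by (simp add: power2_eq_square)
  finally show "cmod (\<alpha> * g + \<beta> * g\<^sup>2) \<le> 83232 * e" .
  assume w: "8 * \<delta> \<le> cmod w" and g: "cmod (g - 1 / w) \<le> \<delta>\<^sup>2 / cmod w ^ 3"
  define D where "D = \<delta>\<^sup>2 / cmod w ^ 3"
  have "cmod w > 0" using w assms(1) by linarith
  have "cmod (1 / w) \<le> 1 / \<delta>" using w assms(1) \<open>cmod w > 0\<close> by (simp add: norm_divide frac_le)
  then have gw: "cmod (g + 1 / w) \<le> 73 / \<delta>"
    using norm_triangle_ineq[of g "1 / w"] assms(4) by (simp add: add_divide_distrib[symmetric])
  have "\<alpha> * g + \<beta> * g\<^sup>2 - (\<alpha> / w + \<beta> / w\<^sup>2) = \<alpha> * (g - 1 / w) + \<beta> * ((g - 1 / w) * (g + 1 / w))"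
    by (simp add: power2_eq_square algebra_simps)
  then have "cmod (\<alpha> * g + \<beta> * g\<^sup>2 - (\<alpha> / w + \<beta> / w\<^sup>2))
      \<le> cmod \<alpha> * cmod (g - 1 / w) + cmod \<beta> * (cmod (g - 1 / w) * cmod (g + 1 / w))"
    by (metis norm_mult norm_triangle_ineq)
  also have "\<dots> \<le> (4 * \<delta> * e) * D + (16 * \<delta>\<^sup>2 * e) * (D * (73 / \<delta>))"
    using assms e g gw by (intro add_mono mult_mono) (auto simp: D_def)
  also have "\<dots> = 1172 * e * \<delta> ^ 3 / cmod w ^ 3"
    using assms(1) by (simp add: D_def power2_eq_square power3_eq_cube mult_ac)
  finally show "cmod (\<alpha> * g + \<beta> * g\<^sup>2 - (\<alpha> / w + \<beta> / w\<^sup>2)) \<le> 1172 * e * \<delta> ^ 3 / cmod w ^ 3" .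
qed

section \<open>Summation, extension and component estimates\<close>

text \<open>The maximum dominates both coordinates, so the summand is at most a product of one
  factor with exponent \<open>-3/2\<close> in each coordinate, and the planar sum is controlled by
  the square of a convergent series.\<close>

lemma sum_inverse_cube_bounded:
  obtains C :: real where "C > 0"
    "\<And>S :: (int \<times> int) set. finite S \<Longrightarrow>
       (\<Sum>(m, n)\<in>S. 1 / (1 + real_of_int (max \<bar>m\<bar> \<bar>n\<bar>)) ^ 3) \<le> C"
proof -
  define b where "b = (\<lambda>n. real (Suc n) powr (-3/2))"
  define a where "a = (\<lambda>m::int. (1 + real_of_int \<bar>m\<bar>) powr (-3/2))"
  have "summable (\<lambda>n. real n powr (-3/2))" by (simp add: summable_real_powr_iff)
  then have b: "summable b" unfolding b_def by (subst summable_Suc_iff[of "\<lambda>n. real n powr (-3/2)"])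
  have part: "sum a P \<le> suminf b" if P: "finite P" "inj_on (\<lambda>m. nat \<bar>m\<bar>) P" for P
  proof -
    have "sum a P = sum b ((\<lambda>m. nat \<bar>m\<bar>) ` P)"
      using P by (simp add: sum.reindex a_def b_def o_def add_ac)
    also have "\<dots> \<le> suminf b" using P b by (intro sum_le_suminf) (auto simp: b_def)
    finally show ?thesis .
  qed
  have line: "sum a T \<le> 2 * suminf b" if T: "finite T" for T
  proof -
    have "sum a T = sum a (T \<inter> {0..}) + sum a (T \<inter> {..<0})"
      using T by (subst sum.union_disjoint[symmetric]) (auto intro!: sum.cong)
    also have "\<dots> \<le> suminf b + suminf b"
      using T by (intro add_mono part) (auto simp: inj_on_def)
    finally show ?thesis by simp
  qed
  have "(\<Sum>(m, n)\<in>S. 1 / (1 + real_of_int (max \<bar>m\<bar> \<bar>n\<bar>)) ^ 3) \<le> (2 * suminf b)\<^sup>2 + 1"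
    if S: "finite S" for S :: "(int \<times> int) set"
  proof -
    have pt: "1 / (1 + real_of_int (max \<bar>m\<bar> \<bar>n\<bar>)) ^ 3 \<le> a m * a n" for m n
    proof -
      define M where "M = 1 + real_of_int (max \<bar>m\<bar> \<bar>n\<bar>)"
      have M: "M > 0" "1 + real_of_int \<bar>m\<bar> \<le> M" "1 + real_of_int \<bar>n\<bar> \<le> M" by (auto simp: M_def)
      have "1 / M ^ 3 = M powr (-3)" using M(1) by (simp add: powr_minus_divide)
      also have "\<dots> = M powr (-3/2) * M powr (-3/2)" by (simp flip: powr_add)
      also have "\<dots> \<le> a m * a n" unfolding a_def
        using M by (intro mult_mono powr_mono2') auto
      finally show ?thesis by (simp add: M_def)
    qed
    have "(\<Sum>(m, n)\<in>S. 1 / (1 + real_of_int (max \<bar>m\<bar> \<bar>n\<bar>)) ^ 3) \<le> (\<Sum>(m, n)\<in>S. a m * a n)"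
      using pt by (intro sum_mono) auto
    also have "\<dots> \<le> (\<Sum>(m, n)\<in>fst ` S \<times> snd ` S. a m * a n)"
      using S by (intro sum_mono2) (auto simp: a_def intro: rev_image_eqI)
    also have "\<dots> = sum a (fst ` S) * sum a (snd ` S)"
      by (simp add: sum_product sum.cartesian_product)
    also have "\<dots> \<le> (2 * suminf b) * (2 * suminf b)"
    proof (intro mult_mono line)
      have "0 \<le> sum a {}" by simp
      also have "\<dots> \<le> 2 * suminf b" by (rule line) simp
      finally show "0 \<le> 2 * suminf b" .
    qed (use S in \<open>auto simp: a_def intro!: sum_nonneg\<close>)
    finally show ?thesis by (simp add: power2_eq_square)
  qed
  moreover have "(2 * suminf b)\<^sup>2 + 1 > 0" by (simp add: add_nonneg_pos)
  ultimately show thesis using that by blast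
qed

lemma continuous_extension_compact_support:
  fixes f :: "complex \<Rightarrow> complex"
  assumes "compact K" "continuous_on K f"
  obtains g R where "continuous_on UNIV g" "\<And>z. z \<in> K \<Longrightarrow> g z = f z"
    "\<And>z. R \<le> cmod z \<Longrightarrow> g z = 0" "\<And>z. z \<in> K \<Longrightarrow> cmod z \<le> R"
proof -
  obtain M where M: "M > 0" "\<And>z. z \<in> K \<Longrightarrow> cmod z \<le> M"
    using compact_imp_bounded[OF assms(1)] unfolding bounded_pos by auto
  obtain h where h: "continuous_on UNIV h" "\<And>z. z \<in> K \<Longrightarrow> h z = f z"
    using Tietze_unbounded[of K f UNIV] assms by (auto simp: compact_imp_closed)
  show thesis
  proof (rule that[of "\<lambda>z. of_real (max 0 (min 1 (M + 1 - cmod z))) * h z" "M + 1"])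
    show "continuous_on UNIV (\<lambda>z. of_real (max 0 (min 1 (M + 1 - cmod z))) * h z)"
      using h(1) by (intro continuous_intros)
    show "of_real (max 0 (min 1 (M + 1 - cmod z))) * h z = f z" if "z \<in> K" for z
      using M(2)[OF that] h(2)[OF that] by simp
    show "cmod z \<le> M + 1" if "z \<in> K" for z using M(2)[OF that] by simp
  qed auto
qed

lemma compact_support_uniformly_continuous:
  fixes g :: "complex \<Rightarrow> complex"
  assumes "continuous_on UNIV g" "\<And>z. R \<le> cmod z \<Longrightarrow> g z = 0"
  shows "uniformly_continuous_on UNIV g"
  unfolding uniformly_continuous_on_def
proof (intro allI impI)
  fix e :: real assume "e > 0"
  have "uniformly_continuous_on (cball 0 (R + 1)) g"
    using assms(1) by (intro compact_uniformly_continuous) (auto intro: continuous_on_subset)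
  then obtain d where d: "d > 0"
    "\<And>x y. x \<in> cball 0 (R + 1) \<Longrightarrow> y \<in> cball 0 (R + 1) \<Longrightarrow> dist y x < d \<Longrightarrow> dist (g y) (g x) < e"
    using \<open>e > 0\<close> unfolding uniformly_continuous_on_def by metis
  have "dist (g y) (g x) < e" if xy: "dist y x < min d 1" for x y
  proof (cases "cmod x \<le> R + 1 \<and> cmod y \<le> R + 1")
    case True
    then show ?thesis using d xy by auto
  next
    case False
    have "\<bar>cmod y - cmod x\<bar> < 1"
      using norm_triangle_ineq3[of y x] xy by (simp add: dist_norm)
    then have "g x = 0" "g y = 0" using False by (auto intro!: assms(2))
    then show ?thesis using \<open>e > 0\<close> by simp
  qed
  then show "\<exists>d>0. \<forall>x\<in>UNIV. \<forall>x'\<in>UNIV. dist x' x < d \<longrightarrow> dist (g x') (g x) < e"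
    using d(1) by (intro exI[of _ "min d 1"]) auto
qed

text \<open>Finiteness of the set of components enters through a minimum over them. Each component
  contains two points at distance \<open>e/2\<close>, and no \<open>q\<close> can be within
  \<open>e/8\<close> of both.\<close>

lemma finite_components_large:
  fixes V :: "complex set"
  assumes "open V" "finite (components V)"
  obtains \<rho> where "\<rho> > 0" "\<And>q. q \<in> V \<Longrightarrow>
    \<exists>U u. open U \<and> connected U \<and> U \<subseteq> V \<and> q \<in> U \<and> u \<in> U \<and> dist q u > \<rho>"
proof -
  have "\<exists>\<rho>>0. \<forall>q\<in>C. \<exists>u\<in>C. dist q u > \<rho>" if C: "C \<in> components V" for C
  proof -
    have "open C" using assms(1) C by (rule open_components)
    moreover obtain x where x: "x \<in> C" using in_components_nonempty[OF C] by blast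
    ultimately obtain e where e: "e > 0" "ball x e \<subseteq> C" using open_contains_ball by blast
    define y where "y = x + of_real (e/2)"
    have xy: "dist x y = e/2" using e by (simp add: y_def dist_norm)
    then have y: "y \<in> C" using e by auto
    have "\<exists>u\<in>C. dist q u > e/8" for q
    proof (rule ccontr)
      assume "\<not> ?thesis"
      then have "dist q x \<le> e/8" "dist q y \<le> e/8" using x y by (auto simp: not_less)
      then show False using dist_triangle3[of x y q] xy e by simp
    qed
    then show ?thesis using e by (intro exI[of _ "e/8"]) auto
  qed
  then obtain \<rho> where \<rho>: "\<And>C. C \<in> components V \<Longrightarrow> \<rho> C > 0"
    "\<And>C q. C \<in> components V \<Longrightarrow> q \<in> C \<Longrightarrow> \<exists>u\<in>C. dist q u > \<rho> C" by metis
  \<comment> \<open>The extra element \<open>1\<close> keeps the set nonempty when \<open>V\<close>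
    has no components.\<close>
  define r where "r = Min (insert (1::real) (\<rho> ` components V))"
  have "r > 0" using assms(2) \<rho>(1) by (simp add: r_def)
  moreover have "\<exists>U u. open U \<and> connected U \<and> U \<subseteq> V \<and> q \<in> U \<and> u \<in> U \<and> dist q u > r"
    if q: "q \<in> V" for q
  proof -
    let ?C = "connected_component_set V q"
    have C: "?C \<in> components V" using q by (rule componentsI)
    then obtain u where u: "u \<in> ?C" "dist q u > \<rho> ?C" using \<rho>(2)[OF C, of q] q by auto
    have "r \<le> \<rho> ?C" unfolding r_def using C assms(2) by (intro Min_le) auto
    then show ?thesis
      using u q C open_components[OF assms(1) C] connected_component_subset[of V q]
      by (intro exI[of _ ?C] exI[of _ u]) auto
  qed
  ultimately show thesis using that by blast
qed

section \<open>Mergelyan approximation\<close>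

context uniform_algebra
begin

text \<open>Formulated for \<open>clo\<close> so that one proof covers rational and polynomial
  approximation: beyond boundedness, the generators matter only through the fractions with a pole
  off \<open>K\<close> that they approximate.\<close>

theorem mergelyan_clo:
  assumes K: "compact K" and poles: "\<And>\<zeta>. \<zeta> \<notin> K \<Longrightarrow> (\<lambda>z. 1 / (z - \<zeta>)) \<in> clo"
    and fin: "finite (components (- K))"
    and f0: "continuous_on K f0" "f0 holomorphic_on interior K"
  shows "f0 \<in> clo"
proof (rule clo_limit)
  fix \<epsilon> :: real assume \<epsilon>: "\<epsilon> > 0"
  obtain f R where f: "continuous_on UNIV f" "\<And>z. z \<in> K \<Longrightarrow> f z = f0 z"
    "\<And>z. R \<le> cmod z \<Longrightarrow> f z = 0" and R: "\<And>z. z \<in> K \<Longrightarrow> cmod z \<le> R"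
    using continuous_extension_compact_support[OF K f0(1)] by metis
  have fhol: "f holomorphic_on interior K"
    using f0(2) f(2) interior_subset by (subst holomorphic_cong[OF refl, of _ f f0]) auto
  obtain C :: real where C: "C > 0"
    "\<And>S :: (int \<times> int) set. finite S \<Longrightarrow>
       (\<Sum>(m, n)\<in>S. 1 / (1 + real_of_int (max \<bar>m\<bar> \<bar>n\<bar>)) ^ 3) \<le> C"
    using sum_inverse_cube_bounded by metis
  \<comment> \<open>Error budget in units of \<open>e\<close>: \<open>625\<close> near cells, each
    with \<open>4\<close> from the Cauchy integral and \<open>83232\<close> from \<open>G\<close>,
    and the far cells with \<open>10400 * C\<close> in total.\<close>
  define A where "A = 625 * 4 + 625 * 83232 + 10400 * C"
  have "A > 0" using C by (simp add: A_def)
  define e where "e = \<epsilon> / (A + 1)"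
  have e: "e > 0" "A * e < \<epsilon>" using \<epsilon> \<open>A > 0\<close> by (simp_all add: e_def field_simps)
  obtain \<eta> where \<eta>: "\<eta> > 0" "\<And>x y. dist x y < \<eta> \<Longrightarrow> dist (f x) (f y) < e"
    using compact_support_uniformly_continuous[OF f(1,3)] e(1)
    unfolding uniformly_continuous_on_def by (metis UNIV_I)
  have "open (- K)" using K by (simp add: compact_imp_closed open_Compl)
  then obtain \<rho> where \<rho>: "\<rho> > 0" "\<And>q. q \<in> - K \<Longrightarrow>
    \<exists>U u. open U \<and> connected U \<and> U \<subseteq> - K \<and> q \<in> U \<and> u \<in> U \<and> dist q u > \<rho>"
    using finite_components_large[OF _ fin] by metis
  \<comment> \<open>\<open>\<delta> \<le> \<rho>\<close> provides a kernel of scale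
    \<open>\<delta>\<close> at each point of the complement, and
    \<open>50 * \<delta> < \<eta>\<close> controls the oscillation of \<open>f\<close> over the
    whole block of near cells.\<close>
  define \<delta> where "\<delta> = min \<rho> (\<eta> / 60)"
  have \<delta>: "\<delta> > 0" "\<delta> \<le> \<rho>" "50 * \<delta> < \<eta>" using \<rho> \<eta> by (auto simp: \<delta>_def)
  have osc: "cmod (f x - f y) \<le> e" if "cmod (x - y) \<le> 50 * \<delta>" for x y
    using \<eta>(2)[of x y] that \<delta>(3) by (simp add: dist_norm less_imp_le)

  \<comment> \<open>Grid cells of side \<open>\<delta>\<close>\<close>
  define lo where "lo = (\<lambda>p :: int \<times> int. gridpt \<delta> (fst p) (snd p))"
  define hi where "hi = (\<lambda>p :: int \<times> int. gridpt \<delta> (fst p + 1) (snd p + 1))"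
  define I where "I = (\<lambda>p. contour_integral (rectpath (lo p) (hi p)))"
  have side: "Re (hi p) = Re (lo p) + \<delta>" "Im (hi p) = Im (lo p) + \<delta>" for p
    by (simp_all add: lo_def hi_def gridpt_simps[OF \<delta>(1)] algebra_simps)
  have path_cell: "path_image (rectpath (lo p) (hi p)) \<subseteq> cbox (lo p) (hi p)" for p
    using side \<delta>(1) by (intro path_image_rectpath_subset_cbox) auto
  have cell_dist: "cmod (x - y) \<le> 2 * \<delta>" if "x \<in> cbox (lo p) (hi p)" "y \<in> cbox (lo p) (hi p)" for x y p
  proof -
    have "\<bar>Re (x - y)\<bar> \<le> \<delta>" "\<bar>Im (x - y)\<bar> \<le> \<delta>"
      using that side[of p] by (auto simp: in_cbox_complex_iff)
    then show ?thesis using cmod_le[of "x - y"] by linarith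
  qed

  \<comment> \<open>Kernels for the cells that are not inside the interior of
    \<open>K\<close>\<close>
  define J where "J = {p. \<not> cbox (lo p) (hi p) \<subseteq> interior K}"
  define Q where "Q = (\<lambda>p (g, c). g \<in> clo \<and> (\<forall>z\<in>K. cmod (g z) \<le> 72 / \<delta>) \<and>
     (\<forall>z\<in>K. 8 * \<delta> \<le> cmod (z - c) \<longrightarrow> cmod (g z - 1 / (z - c)) \<le> \<delta>\<^sup>2 / cmod (z - c) ^ 3) \<and>
     (\<forall>\<zeta>\<in>cbox (lo p) (hi p). cmod (\<zeta> - c) \<le> 4 * \<delta>))"
  have "\<exists>gc. Q p gc" if p: "p \<in> J" for p
  proof -
    obtain x where x: "x \<in> cbox (lo p) (hi p)" "x \<notin> interior K" using p by (auto simp: J_def)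
    then have "x \<in> closure (- K)" by (simp add: closure_complement)
    then obtain q where q: "q \<in> - K" "dist q x < \<delta>" using \<delta>(1) closure_approachable by blast
    obtain U u where U: "open U" "connected U" "U \<inter> K = {}" "q \<in> U" "u \<in> U" "dist q u > \<delta>"
      using \<rho>(2)[OF q(1)] \<delta>(2) by fastforce
    obtain g c where gc: "g \<in> clo" "cmod (c - q) \<le> \<delta>" "\<And>z. z \<in> K \<Longrightarrow> cmod (g z) \<le> 72 / \<delta>"
      "\<And>z. z \<in> K \<Longrightarrow> 4 * \<delta> \<le> cmod (z - c) \<Longrightarrow>
         cmod (g z - 1 / (z - c)) \<le> \<delta>\<^sup>2 / cmod (z - c) ^ 3"
      using clo_kernel[OF K poles U(1-5) \<delta>(1) U(6)] by metis
    \<comment> \<open>Points of the cell are at most \<open>2 * \<delta>\<close> apart, and passing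
      from \<open>x\<close> to \<open>q\<close> and from \<open>q\<close> to \<open>c\<close> costs
      at most \<open>\<delta>\<close> each.\<close>
    have "cmod (\<zeta> - c) \<le> 4 * \<delta>" if "\<zeta> \<in> cbox (lo p) (hi p)" for \<zeta>
    proof -
      have "cmod (\<zeta> - c) \<le> cmod (\<zeta> - x) + cmod (x - q) + cmod (q - c)"
        using norm_triangle_ineq[of "\<zeta> - x" "x - q"] norm_triangle_ineq[of "\<zeta> - q" "q - c"] by simp
      moreover have "cmod (x - q) < \<delta>" "cmod (q - c) \<le> \<delta>"
        using q gc(2) by (simp_all add: dist_norm norm_minus_commute)
      ultimately show ?thesis using cell_dist[OF that x(1)] by linarith
    qed
    then have "Q p (g, c)" using gc \<delta>(1) by (auto simp: Q_def)
    then show ?thesis by blast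
  qed
  then obtain gc where gc: "\<And>p. p \<in> J \<Longrightarrow> Q p (gc p)" by metis
  define g c where "g = (\<lambda>p. fst (gc p))" and "c = (\<lambda>p. snd (gc p))"
  have g_clo: "g p \<in> clo" and g_bd: "\<And>z. z \<in> K \<Longrightarrow> cmod (g p z) \<le> 72 / \<delta>"
    and g_far: "\<And>z. z \<in> K \<Longrightarrow> 8 * \<delta> \<le> cmod (z - c p) \<Longrightarrow>
      cmod (g p z - 1 / (z - c p)) \<le> \<delta>\<^sup>2 / cmod (z - c p) ^ 3"
    and c_near: "\<And>\<zeta>. \<zeta> \<in> cbox (lo p) (hi p) \<Longrightarrow> cmod (\<zeta> - c p) \<le> 4 * \<delta>" if "p \<in> J" for p
    using gc[OF that] by (auto simp: Q_def g_def c_def split: prod.splits)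

  \<comment> \<open>Replacing cell integrals by functions in \<open>clo\<close>\<close>
  define \<alpha> where "\<alpha> = (\<lambda>p. I p f)"
  define \<beta> where "\<beta> = (\<lambda>p. I p (\<lambda>\<zeta>. f \<zeta> * (\<zeta> - c p)))"
  define G where "G = (\<lambda>p z. \<alpha> p * g p z + \<beta> p * (g p z)\<^sup>2)"
  have f_cell: "continuous_on (cbox (lo p) (hi p)) f" for p
    using f(1) continuous_on_subset by blast
  have f_osc: "cmod (f \<zeta> - f (lo p)) \<le> e" if "\<zeta> \<in> cbox (lo p) (hi p)" for \<zeta> p
  proof (rule osc)
    have "lo p \<in> cbox (lo p) (hi p)" using side[of p] \<delta>(1) by (simp add: in_cbox_complex_iff)
    then show "cmod (\<zeta> - lo p) \<le> 50 * \<delta>" using cell_dist[OF that] \<delta>(1) by force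
  qed
  have \<alpha>_bd: "cmod (\<alpha> p) \<le> 4 * \<delta> * e" and \<beta>_bd: "cmod (\<beta> p) \<le> 16 * \<delta>\<^sup>2 * e"
    and expansion: "\<And>z. 8 * \<delta> \<le> cmod (z - c p) \<Longrightarrow>
      cmod (I p (\<lambda>\<zeta>. f \<zeta> / (\<zeta> - z)) + (\<alpha> p / (z - c p) + \<beta> p / (z - c p)\<^sup>2))
        \<le> 128 * e * \<delta> ^ 3 / cmod (z - c p) ^ 3" if "p \<in> J" for p
    using cell_expansion[where lo = "lo p" and hi = "hi p" and c = "c p" and v = "f (lo p)",
        OF side \<delta>(1) f_cell f_osc c_near[OF that]]
    unfolding \<alpha>_def \<beta>_def I_def by simp_all
  have G_bd: "cmod (G p z) \<le> 83232 * e" if "p \<in> J" "z \<in> K" for p z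
    unfolding G_def
    by (rule kernel_combination(1)[OF \<delta>(1) \<alpha>_bd[OF that(1)] \<beta>_bd[OF that(1)] g_bd[OF that]])
  have G_far: "cmod (I p (\<lambda>\<zeta>. f \<zeta> / (\<zeta> - z)) + G p z) \<le> 1300 * e * \<delta> ^ 3 / cmod (z - c p) ^ 3"
    if p: "p \<in> J" and z: "z \<in> K" "8 * \<delta> \<le> cmod (z - c p)" for p z
  proof -
    let ?S = "\<alpha> p / (z - c p) + \<beta> p / (z - c p)\<^sup>2"
    have "cmod (I p (\<lambda>\<zeta>. f \<zeta> / (\<zeta> - z)) + ?S) \<le> 128 * e * \<delta> ^ 3 / cmod (z - c p) ^ 3"
      by (rule expansion[OF p z(2)])
    moreover have "cmod (G p z - ?S) \<le> 1172 * e * \<delta> ^ 3 / cmod (z - c p) ^ 3"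
      unfolding G_def
      by (rule kernel_combination(2)[OF \<delta>(1) \<alpha>_bd[OF p] \<beta>_bd[OF p] g_bd[OF p z(1)] z(2) g_far[OF p z]])
    ultimately have "cmod ((I p (\<lambda>\<zeta>. f \<zeta> / (\<zeta> - z)) + ?S) + (G p z - ?S))
      \<le> 128 * e * \<delta> ^ 3 / cmod (z - c p) ^ 3 + 1172 * e * \<delta> ^ 3 / cmod (z - c p) ^ 3"
      by (rule norm_triangle_mono)
    then show ?thesis by (simp add: add_divide_distrib[symmetric])
  qed

  \<comment> \<open>The finite box and the approximant\<close>
  define N where "N = \<lceil>R / \<delta>\<rceil> + 20"
  \<comment> \<open>Twenty cells of margin let the block around any \<open>z \<in> K\<close> fit
    into \<open>Box\<close> and put the boundary of \<open>Box\<close> where \<open>f\<close>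
    vanishes.\<close>
  have N: "\<delta> * of_int N \<ge> R + 20 * \<delta>"
  proof -
    have "R / \<delta> + 20 \<le> of_int N" by (simp add: N_def)
    then have "\<delta> * (R / \<delta> + 20) \<le> \<delta> * of_int N" using \<delta>(1) by (intro mult_left_mono) auto
    then show ?thesis using \<delta>(1) by (simp add: algebra_simps)
  qed
  define Box where "Box = {-N..<N} \<times> {-N..<N}"
  have finB: "finite Box" by (simp add: Box_def)
  \<comment> \<open>The minus sign of \<open>1 / (\<zeta> - z) = - 1 / (z - c) - \<dots>\<close> makes \<open>T\<close> approximate \<open>f\<close>, not \<open>- f\<close>.\<close>
  define T where "T = (\<lambda>z. 1 / (2 * of_real pi * \<i>) * (\<Sum>p\<in>Box \<inter> J. G p z))"
  have "T \<in> clo" unfolding T_def G_def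
    by (intro clo_cmult clo_sum clo_add clo_power g_clo) auto

  \<comment> \<open>Error at a point of \<open>K\<close>\<close>
  moreover have "cmod (f0 z - T z) < \<epsilon>" if z: "z \<in> K" for z
  proof -
    define k l where "k = \<lfloor>Re z / \<delta>\<rfloor>" and "l = \<lfloor>Im z / \<delta>\<rfloor>"
    have kl: "\<delta> * of_int k \<le> Re z" "Re z < \<delta> * of_int k + \<delta>"
      "\<delta> * of_int l \<le> Im z" "Im z < \<delta> * of_int l + \<delta>"
    proof -
      have "of_int k \<le> Re z / \<delta>" "Re z / \<delta> < of_int k + 1"
        "of_int l \<le> Im z / \<delta>" "Im z / \<delta> < of_int l + 1"
        unfolding k_def l_def by linarith+
      then show "\<delta> * of_int k \<le> Re z" "Re z < \<delta> * of_int k + \<delta>"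
        "\<delta> * of_int l \<le> Im z" "Im z < \<delta> * of_int l + \<delta>"
        using \<delta>(1) by (simp_all add: field_simps)
    qed
    have grid_le: "m \<le> n" if "\<delta> * of_int m \<le> \<delta> * of_int n" for m n
      using that \<delta>(1) by simp
    have zR: "\<bar>Re z\<bar> \<le> R" "\<bar>Im z\<bar> \<le> R"
      using R[OF z] abs_Re_le_cmod[of z] abs_Im_le_cmod[of z] by linarith+
    \<comment> \<open>A block of \<open>25\<close> by \<open>25\<close> cells centred at the cell of
      \<open>z\<close>: its boundary stays at least \<open>12 * \<delta>\<close> away from
      \<open>z\<close>, which leaves room for the far expansion outside it.\<close>
    define near where "near = {k - 12..<k + 13} \<times> {l - 12..<l + 13}"
    have near_Box: "near \<subseteq> Box"
    proof -
      have "k + 13 \<le> N" "- N \<le> k - 12" "l + 13 \<le> N" "- N \<le> l - 12"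
        using kl zR N \<delta>(1) by (auto intro!: grid_le simp: algebra_simps)
      then show ?thesis by (auto simp: near_def Box_def)
    qed
    have card_near: "card near = 625" by (simp add: near_def)

    \<comment> \<open>The Cauchy kernel, made continuous on the whole plane so that its integrals telescope.\<close>
    define \<kappa> where "\<kappa> = (\<lambda>\<zeta>. cnj (\<zeta> - z) / of_real (max (cmod (\<zeta> - z) ^ 2) (\<delta>\<^sup>2)))"
    have "max (cmod (\<zeta> - z) ^ 2) (\<delta>\<^sup>2) \<noteq> 0" for \<zeta>
      using \<delta>(1) by (metis less_max_iff_disj order_less_irrefl zero_less_power)
    then have "(of_real (max (cmod (\<zeta> - z) ^ 2) (\<delta>\<^sup>2)) :: complex) \<noteq> 0" for \<zeta>
      by (simp only: of_real_eq_0_iff not_False_eq_True)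
    then have \<kappa>_cont: "continuous_on UNIV \<kappa>"
      unfolding \<kappa>_def by (intro continuous_intros ballI)
    have \<kappa>_eq: "\<kappa> \<zeta> = 1 / (\<zeta> - z)" if "\<delta> \<le> cmod (\<zeta> - z)" for \<zeta>
    proof -
      have "\<delta>\<^sup>2 \<le> cmod (\<zeta> - z) ^ 2" using that \<delta>(1) by (intro power_mono) auto
      then have "\<kappa> \<zeta> = cnj (\<zeta> - z) / ((\<zeta> - z) * cnj (\<zeta> - z))"
        by (simp only: \<kappa>_def max_absorb1 complex_norm_square)
      moreover have "cnj (\<zeta> - z) \<noteq> 0" using that \<delta>(1) by auto
      ultimately show ?thesis by (metis divide_divide_eq_left' divide_self mult.commute)
    qed
    have \<kappa>_bd: "cmod (\<kappa> \<zeta>) \<le> 1 / \<delta>" for \<zeta>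
    proof (cases "\<delta> \<le> cmod (\<zeta> - z)")
      case True
      then show ?thesis using \<kappa>_eq[OF True] \<delta>(1) by (simp add: norm_divide frac_le)
    next
      case False
      then have "cmod (\<zeta> - z) ^ 2 \<le> \<delta>\<^sup>2" by (intro power_mono) auto
      then have "cmod (\<kappa> \<zeta>) = cmod (\<zeta> - z) / \<delta>\<^sup>2"
        unfolding \<kappa>_def norm_divide complex_mod_cnj by (simp add: max_absorb2 norm_power)
      also have "\<dots> \<le> \<delta> / \<delta>\<^sup>2" using False by (intro divide_right_mono) auto
      finally show ?thesis using \<delta>(1) by (simp add: power2_eq_square)
    qed
    have int: "h contour_integrable_on rectpath x y" if "continuous_on UNIV h" for h x y
      using rectpath_integrable continuous_on_subset[OF that] by blast
    have block: "(\<Sum>p\<in>{a..<b} \<times> {a'..<b'}. I p h)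
        = contour_integral (rectpath (gridpt \<delta> a a') (gridpt \<delta> b b')) h"
      if "continuous_on UNIV h" "a \<le> b" "a' \<le> b'" for a b a' b' h
      using sum_cells[OF \<delta>(1) that] by (simp add: sum.cartesian_product I_def lo_def hi_def case_prod_unfold)

    \<comment> \<open>The integrals over all cells of \<open>Box\<close> telescope to its boundary,
      where \<open>f\<close> vanishes; hence near and far cells balance.\<close>
    have total: "(\<Sum>p\<in>Box. I p (\<lambda>\<zeta>. f \<zeta> * \<kappa> \<zeta>)) = 0"
    proof -
      have "0 \<le> R" using R[OF z] norm_ge_zero order_trans by blast
      then have "0 < \<delta> * of_int N" using N \<delta>(1) by linarith
      then have N0: "N \<ge> 0" using \<delta>(1) by (simp add: zero_less_mult_iff)
      have "continuous_on UNIV (\<lambda>\<zeta>. f \<zeta> * \<kappa> \<zeta>)" by (intro continuous_intros f \<kappa>_cont)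
      then have "(\<Sum>p\<in>Box. I p (\<lambda>\<zeta>. f \<zeta> * \<kappa> \<zeta>))
         = contour_integral (rectpath (gridpt \<delta> (-N) (-N)) (gridpt \<delta> N N)) (\<lambda>\<zeta>. f \<zeta> * \<kappa> \<zeta>)"
        unfolding Box_def using N0 by (intro block) auto
      also have "\<dots> = contour_integral (rectpath (gridpt \<delta> (-N) (-N)) (gridpt \<delta> N N)) (\<lambda>\<zeta>. 0)"
      proof (rule contour_integral_eq)
        fix \<zeta> assume "\<zeta> \<in> path_image (rectpath (gridpt \<delta> (-N) (-N)) (gridpt \<delta> N N))"
        then have "\<bar>Re \<zeta>\<bar> = \<delta> * of_int N \<or> \<bar>Im \<zeta>\<bar> = \<delta> * of_int N"
          using N0 \<delta>(1) by (subst (asm) path_image_rectpath) (auto simp: gridpt_simps[OF \<delta>(1)])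
        then have "R \<le> cmod \<zeta>"
          using abs_Re_le_cmod[of \<zeta>] abs_Im_le_cmod[of \<zeta>] N \<delta>(1) by linarith
        then show "f \<zeta> * \<kappa> \<zeta> = 0" by (simp add: f(3))
      qed
      finally show ?thesis by simp
    qed

    \<comment> \<open>The block boundary avoids the region where \<open>\<kappa>\<close> was
      modified, so the telescoped integral is that of \<open>1 / (\<zeta> - z)\<close>, with winding
      number \<open>1\<close>.\<close>
    have near_kappa: "(\<Sum>p\<in>near. I p \<kappa>) = 2 * of_real pi * \<i>"
    proof -
      define a b where "a = gridpt \<delta> (k - 12) (l - 12)" and "b = gridpt \<delta> (k + 13) (l + 13)"
      have ab: "Re a \<le> Re z - 12 * \<delta>" "Im a \<le> Im z - 12 * \<delta>"
         "Re z + 12 * \<delta> \<le> Re b" "Im z + 12 * \<delta> \<le> Im b"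
        using kl by (auto simp: a_def b_def gridpt_simps[OF \<delta>(1)] algebra_simps)
      have "z \<in> box a b" using ab \<delta>(1) by (simp add: in_box_complex_iff)
      have le: "Re a \<le> Re b" "Im a \<le> Im b" using ab \<delta>(1) by linarith+
      have "(\<Sum>p\<in>near. I p \<kappa>) = contour_integral (rectpath a b) \<kappa>"
        unfolding near_def a_def b_def by (intro block \<kappa>_cont) auto
      also have "\<dots> = contour_integral (rectpath a b) (\<lambda>\<zeta>. 1 / (\<zeta> - z))"
      proof (rule contour_integral_eq, rule \<kappa>_eq)
        fix \<zeta> assume "\<zeta> \<in> path_image (rectpath a b)"
        then have "12 * \<delta> \<le> \<bar>Re (\<zeta> - z)\<bar> \<or> 12 * \<delta> \<le> \<bar>Im (\<zeta> - z)\<bar>"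
          using ab by (subst (asm) path_image_rectpath[OF le]) auto
        then show "\<delta> \<le> cmod (\<zeta> - z)"
          using abs_Re_le_cmod[of "\<zeta> - z"] abs_Im_le_cmod[of "\<zeta> - z"] \<delta>(1) by linarith
      qed
      also have "\<dots> = 2 * of_real pi * \<i>"
        using winding_number_rectpath[OF \<open>z \<in> box a b\<close>] winding_number_valid_path[of "rectpath a b" z]
          \<open>z \<in> box a b\<close> path_image_rectpath_inter_box[OF le] by (auto simp: field_simps)
      finally show ?thesis .
    qed
    have near_dist: "cmod (\<zeta> - z) \<le> 50 * \<delta>" if "p \<in> near" "\<zeta> \<in> cbox (lo p) (hi p)" for p \<zeta>
    proof -
      have "of_int (fst p) \<le> (of_int k + 12 :: real)" "of_int k - 12 \<le> (of_int (fst p) :: real)"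
        "of_int (snd p) \<le> (of_int l + 12 :: real)" "of_int l - 12 \<le> (of_int (snd p) :: real)"
        using that(1) by (auto simp: near_def)
      then have "\<delta> * of_int (fst p) \<le> \<delta> * (of_int k + 12)" "\<delta> * (of_int k - 12) \<le> \<delta> * of_int (fst p)"
        "\<delta> * of_int (snd p) \<le> \<delta> * (of_int l + 12)" "\<delta> * (of_int l - 12) \<le> \<delta> * of_int (snd p)"
        using \<delta>(1) by simp_all
      then have "\<bar>Re (\<zeta> - z)\<bar> \<le> 13 * \<delta>" "\<bar>Im (\<zeta> - z)\<bar> \<le> 13 * \<delta>"
        using that(2) kl
        by (auto simp: in_cbox_complex_iff lo_def hi_def gridpt_simps[OF \<delta>(1)] algebra_simps)
      then show ?thesis using cmod_le[of "\<zeta> - z"] \<delta>(1) by linarith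
    qed
    \<comment> \<open>Subtracting \<open>f z\<close> leaves the main term
      \<open>2 * of_real pi * \<i> * f z\<close> and an error governed by oscillation: perimeter
      \<open>4 * \<delta>\<close> times \<open>e / \<delta>\<close>.\<close>
    define E1 where "E1 = (\<lambda>p. I p (\<lambda>\<zeta>. (f \<zeta> - f z) * \<kappa> \<zeta>))"
    have E1: "cmod (E1 p) \<le> 4 * e" if p: "p \<in> near" for p
    proof -
      have "cmod (E1 p) \<le> 4 * \<delta> * (e * (1 / \<delta>))"
        unfolding E1_def I_def
      proof (rule rectpath_integral_bound[OF _ side])
        show "continuous_on (path_image (rectpath (lo p) (hi p))) (\<lambda>\<zeta>. (f \<zeta> - f z) * \<kappa> \<zeta>)"
          by (rule continuous_on_subset[of UNIV]) (auto intro!: continuous_intros f \<kappa>_cont)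
        show "cmod ((f \<zeta> - f z) * \<kappa> \<zeta>) \<le> e * (1 / \<delta>)"
          if "\<zeta> \<in> path_image (rectpath (lo p) (hi p))" for \<zeta>
          unfolding norm_mult using that path_cell[of p] near_dist[OF p] e(1)
          by (intro mult_mono \<kappa>_bd osc) auto
      qed (use \<delta> in auto)
      then show ?thesis using \<delta>(1) by simp
    qed
    have near_sum: "(\<Sum>p\<in>near. I p (\<lambda>\<zeta>. f \<zeta> * \<kappa> \<zeta>)) = 2 * of_real pi * \<i> * f z + sum E1 near"
    proof -
      have "I p (\<lambda>\<zeta>. f \<zeta> * \<kappa> \<zeta>) = f z * I p \<kappa> + E1 p" for p
      proof -
        have "I p (\<lambda>\<zeta>. f z * \<kappa> \<zeta> + (f \<zeta> - f z) * \<kappa> \<zeta>) = I p (\<lambda>\<zeta>. f z * \<kappa> \<zeta>) + E1 p"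
          unfolding I_def E1_def by (intro contour_integral_add int continuous_intros f \<kappa>_cont)
        moreover have "I p (\<lambda>\<zeta>. f z * \<kappa> \<zeta>) = f z * I p \<kappa>"
          unfolding I_def by (intro contour_integral_lmul int \<kappa>_cont)
        ultimately show ?thesis by (simp add: algebra_simps)
      qed
      then show ?thesis by (simp add: sum.distrib near_kappa flip: sum_distrib_left)
    qed

    \<comment> \<open>Distance from the cell of \<open>z\<close>, counted in cells in the maximum
      norm, to match the index of the inverse cube sum.\<close>
    define D where "D = (\<lambda>p. max \<bar>fst p - k\<bar> \<bar>snd p - l\<bar>)"
    have far_D: "D p \<ge> 13" if "p \<notin> near" for p
      using that by (cases p) (auto simp: near_def D_def)
    have far_dist: "(of_int (D p) - 1) * \<delta> \<le> cmod (\<zeta> - z)" if \<zeta>: "\<zeta> \<in> cbox (lo p) (hi p)" for p \<zeta>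
    proof -
      have 1: "\<bar>Re (\<zeta> - z) - \<delta> * of_int (fst p - k)\<bar> \<le> \<delta>" "\<bar>Im (\<zeta> - z) - \<delta> * of_int (snd p - l)\<bar> \<le> \<delta>"
        using \<zeta> kl by (auto simp: in_cbox_complex_iff lo_def hi_def gridpt_simps[OF \<delta>(1)] algebra_simps)
      have 2: "\<bar>\<delta> * of_int x\<bar> = of_int \<bar>x\<bar> * \<delta>" for x :: int using \<delta>(1) by (simp add: abs_mult)
      have "(of_int \<bar>fst p - k\<bar> - 1) * \<delta> \<le> \<bar>Re (\<zeta> - z)\<bar>" "(of_int \<bar>snd p - l\<bar> - 1) * \<delta> \<le> \<bar>Im (\<zeta> - z)\<bar>"
        using 1 2[of "fst p - k"] 2[of "snd p - l"] unfolding left_diff_distrib by linarith+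
      then show ?thesis
        using abs_Re_le_cmod[of "\<zeta> - z"] abs_Im_le_cmod[of "\<zeta> - z"] unfolding D_def max_def
        by (auto split: if_splits)
    qed
    \<comment> \<open>Cells in \<open>J\<close> cancel their integral against \<open>G\<close> up to
      third order. The other cells contribute nothing by Cauchy's theorem, since outside
      \<open>near\<close> they do not contain \<open>z\<close>.\<close>
    define E2 where "E2 = (\<lambda>p. I p (\<lambda>\<zeta>. f \<zeta> * \<kappa> \<zeta>) + (if p \<in> J then G p z else 0))"
    have E2: "cmod (E2 p) \<le> 10400 * e * (1 / (1 + of_int (D p)) ^ 3)" if p: "p \<notin> near" for p
    proof -
      have D13: "real_of_int (D p) \<ge> 13" using far_D[OF p] by linarith
      have far: "12 * \<delta> \<le> cmod (\<zeta> - z)" if "\<zeta> \<in> cbox (lo p) (hi p)" for \<zeta>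
      proof -
        have "12 * \<delta> \<le> (of_int (D p) - 1) * \<delta>" using D13 \<delta>(1) by (intro mult_right_mono) auto
        then show ?thesis using far_dist[OF that] by linarith
      qed
      have I_eq: "I p (\<lambda>\<zeta>. f \<zeta> * \<kappa> \<zeta>) = I p (\<lambda>\<zeta>. f \<zeta> / (\<zeta> - z))"
        unfolding I_def
      proof (rule contour_integral_eq)
        fix \<zeta> assume "\<zeta> \<in> path_image (rectpath (lo p) (hi p))"
        then have "\<delta> \<le> cmod (\<zeta> - z)" using far path_cell[of p] \<delta>(1) by force
        then show "f \<zeta> * \<kappa> \<zeta> = f \<zeta> / (\<zeta> - z)" by (simp add: \<kappa>_eq)
      qed
      show ?thesis
      proof (cases "p \<in> J")
        case True
        have lop: "lo p \<in> cbox (lo p) (hi p)" using side[of p] \<delta>(1) by (simp add: in_cbox_complex_iff)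
        have "cmod (lo p - z) \<le> cmod (lo p - c p) + cmod (z - c p)"
          using norm_triangle_ineq4[of "lo p - c p" "z - c p"] by simp
        \<comment> \<open>Subtracting \<open>4 * \<delta>\<close> for the distance to
          \<open>c p\<close> leaves \<open>D p - 5\<close> cells, which for
          \<open>D p \<ge> 13\<close> is at least \<open>8\<close> and at least
          \<open>(1 + D p) / 2\<close>. Cubing the factor \<open>1/2\<close> turns
          \<open>1300\<close> into \<open>10400\<close>.\<close>
        then have w5: "(of_int (D p) - 5) * \<delta> \<le> cmod (z - c p)"
          using far_dist[OF lop] c_near[OF True lop] unfolding left_diff_distrib by linarith
        have "8 * \<delta> \<le> (of_int (D p) - 5) * \<delta>" using D13 \<delta>(1) by (intro mult_right_mono) auto
        then have w8: "8 * \<delta> \<le> cmod (z - c p)" using w5 by linarith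
        have "(1 + of_int (D p)) / 2 * \<delta> \<le> (of_int (D p) - 5) * \<delta>"
          using D13 \<delta>(1) by (intro mult_right_mono) auto
        then have w: "(1 + of_int (D p)) / 2 * \<delta> \<le> cmod (z - c p)" using w5 by linarith
        have "cmod (E2 p) \<le> 1300 * e * \<delta> ^ 3 / cmod (z - c p) ^ 3"
          using G_far[OF True z w8] True by (simp add: E2_def I_eq)
        also have "\<dots> \<le> 1300 * e * \<delta> ^ 3 / ((1 + of_int (D p)) / 2 * \<delta>) ^ 3"
          using w D13 \<delta>(1) e(1) by (intro frac_le power_mono) auto
        also have "\<dots> = 10400 * e * (1 / (1 + of_int (D p)) ^ 3)"
          using \<delta>(1) D13 by (simp add: power_mult_distrib power_divide)
        finally show ?thesis .
      next
        case False
        then have sub: "cbox (lo p) (hi p) \<subseteq> interior K" by (simp add: J_def)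
        have nz: "\<zeta> - z \<noteq> 0" if "\<zeta> \<in> cbox (lo p) (hi p)" for \<zeta> using far[OF that] \<delta>(1) by auto
        have hol: "(\<lambda>\<zeta>. f \<zeta> / (\<zeta> - z)) holomorphic_on cbox (lo p) (hi p)"
          using nz by (intro holomorphic_intros holomorphic_on_subset[OF fhol sub]) auto
        have "I p (\<lambda>\<zeta>. f \<zeta> / (\<zeta> - z)) = 0"
          unfolding I_def using side[of p] \<delta>(1)
          by (intro rectpath_Cauchy holomorphic_on_imp_continuous_on[OF hol]
              holomorphic_on_subset[OF hol] interior_subset) auto
        then have "E2 p = 0" using False by (simp add: E2_def I_eq)
        then show ?thesis using e(1) D13 by simp
      qed
    qed
    have far_sum: "cmod (\<Sum>p\<in>Box - near. E2 p) \<le> 10400 * C * e"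
    proof -
      have "cmod (\<Sum>p\<in>Box - near. E2 p) \<le> (\<Sum>p\<in>Box - near. 10400 * e * (1 / (1 + of_int (D p)) ^ 3))"
        by (intro sum_norm_le E2) auto
      also have "\<dots> = 10400 * e * (\<Sum>p\<in>Box - near. 1 / (1 + of_int (D p)) ^ 3)"
        by (simp only: sum_distrib_left)
      \<comment> \<open>Shifting by \<open>(k, l)\<close> brings the sum into the form bounded by
        \<open>C\<close>, which is independent of \<open>z\<close>.\<close>
      also have "(\<Sum>p\<in>Box - near. 1 / (1 + real_of_int (D p)) ^ 3)
          = (\<Sum>(m, n)\<in>(\<lambda>p. (fst p - k, snd p - l)) ` (Box - near).
               1 / (1 + real_of_int (max \<bar>m\<bar> \<bar>n\<bar>)) ^ 3)"
        by (subst sum.reindex) (auto simp: inj_on_def D_def)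
      also have "10400 * e * \<dots> \<le> 10400 * e * C"
        using finB e(1) by (intro mult_left_mono C(2)) auto
      finally show ?thesis by (simp add: mult_ac)
    qed
    have J_sum: "(\<Sum>p\<in>S. if p \<in> J then G p z else 0) = (\<Sum>p\<in>S \<inter> J. G p z)" if "finite S" for S
      using sum.inter_restrict[OF that, of "\<lambda>p. G p z" J] by simp
    have fin: "finite near" "finite (Box - near)" using finB by (auto simp: near_def)
    have split: "sum h Box = sum h near + sum h (Box - near)" for h :: "int \<times> int \<Rightarrow> complex"
      using sum.subset_diff[OF near_Box finB, of h] by (simp add: add.commute)
    have split_J: "(\<Sum>p\<in>Box \<inter> J. G p z) = (\<Sum>p\<in>near \<inter> J. G p z) + (\<Sum>p\<in>(Box - near) \<inter> J. G p z)"
      using split[of "\<lambda>p. if p \<in> J then G p z else 0"] by (simp only: J_sum fin finB)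
    have "(2 * of_real pi * \<i> * f z + sum E1 near) + (\<Sum>p\<in>Box - near. I p (\<lambda>\<zeta>. f \<zeta> * \<kappa> \<zeta>)) = 0"
      using total near_sum split[of "\<lambda>p. I p (\<lambda>\<zeta>. f \<zeta> * \<kappa> \<zeta>)"] by metis
    then have far_I: "(\<Sum>p\<in>Box - near. I p (\<lambda>\<zeta>. f \<zeta> * \<kappa> \<zeta>)) = - (2 * of_real pi * \<i> * f z + sum E1 near)"
      by (rule minus_unique[symmetric])
    have "(\<Sum>p\<in>Box - near. E2 p) = (\<Sum>p\<in>Box - near. I p (\<lambda>\<zeta>. f \<zeta> * \<kappa> \<zeta>)) + (\<Sum>p\<in>(Box - near) \<inter> J. G p z)"
      by (simp only: E2_def sum.distrib J_sum[OF fin(2)])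
    \<comment> \<open>Three errors remain: oscillation on near cells, third order remainders on far
      cells, and the terms \<open>G\<close> of near cells, which are bounded without any
      cancellation.\<close>
    then have "2 * of_real pi * \<i> * f z - (\<Sum>p\<in>Box \<inter> J. G p z)
        = - sum E1 near - (\<Sum>p\<in>Box - near. E2 p) - (\<Sum>p\<in>near \<inter> J. G p z)"
      by (simp add: far_I split_J)
    also have "cmod \<dots> \<le> cmod (sum E1 near) + cmod (\<Sum>p\<in>Box - near. E2 p) + cmod (\<Sum>p\<in>near \<inter> J. G p z)"
      using norm_triangle_ineq4[of "- sum E1 near - (\<Sum>p\<in>Box - near. E2 p)" "\<Sum>p\<in>near \<inter> J. G p z"]
        norm_triangle_ineq4[of "- sum E1 near" "\<Sum>p\<in>Box - near. E2 p"] by simp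
    also have "cmod (sum E1 near) \<le> 625 * (4 * e)"
      using sum_norm_bound[of near E1 "4 * e"] E1 card_near by simp
    also have "cmod (\<Sum>p\<in>near \<inter> J. G p z) \<le> 625 * (83232 * e)"
    proof -
      have "cmod (\<Sum>p\<in>near \<inter> J. G p z) \<le> of_nat (card (near \<inter> J)) * (83232 * e)"
        by (intro sum_norm_bound G_bd z) auto
      also have "\<dots> \<le> 625 * (83232 * e)"
        using card_mono[OF fin(1), of "near \<inter> J"] card_near e(1) by (intro mult_right_mono) auto
      finally show ?thesis .
    qed
    also note far_sum
    finally have "cmod (2 * of_real pi * \<i> * f z - (\<Sum>p\<in>Box \<inter> J. G p z)) \<le> A * e"
      by (simp add: A_def algebra_simps)
    moreover have "2 * of_real pi * \<i> * f z - (\<Sum>p\<in>Box \<inter> J. G p z) = 2 * of_real pi * \<i> * (f z - T z)"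
      by (simp add: T_def right_diff_distrib)
    ultimately have "2 * pi * cmod (f z - T z) \<le> A * e" by (simp add: norm_mult)
    moreover have "cmod (f z - T z) \<le> 2 * pi * cmod (f z - T z)"
      using pi_gt3 by (intro mult_le_cancel_right1[THEN iffD2]) auto
    ultimately show ?thesis using e(2) f(2)[OF z] by simp
  qed
  ultimately show "\<exists>g\<in>clo. \<forall>z\<in>K. cmod (f0 z - g z) < \<epsilon>" by (intro bexI) auto
qed

end

section \<open>Rational functions, polynomials and bicomplex approximation\<close>

lemma isCont_not_pole:
  fixes f :: "complex \<Rightarrow> complex"
  assumes "isCont f z"
  shows "\<not> is_pole f z"
  using not_tendsto_and_filterlim_at_infinity[OF at_neq_bot assms[unfolded isCont_def]]
  by (auto simp: is_pole_def)

text \<open>The limit at infinity is carried along to exclude \<open>Infty\<close> as a pole. The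
  fraction is not yet in lowest terms, and the formula is claimed only off the roots of
  \<open>q\<close>.\<close>

lemma gen_alg_inverse_rational:
  assumes "r \<in> gen_alg ((\<lambda>p z. 1 / (z - p)) ` P)"
  shows "\<exists>p q l. q \<noteq> 0 \<and> (\<forall>z. poly q z = 0 \<longrightarrow> z \<in> P) \<and>
    (\<forall>z. poly q z \<noteq> 0 \<longrightarrow> r z = poly p z / poly q z) \<and> (r \<longlongrightarrow> l) at_infinity"
  using assms
proof (induction rule: gen_alg.induct)
  case (const c)
  show ?case by (rule exI[of _ "[:c:]"], rule exI[of _ 1], rule exI[of _ c]) simp
next
  case (gen b)
  then obtain a where a: "a \<in> P" "b = (\<lambda>z. 1 / (z - a))" by auto
  have "filterlim (\<lambda>z. z - a) at_infinity at_infinity"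
    using tendsto_add_filterlim_at_infinity'[OF filterlim_ident tendsto_const[of "-a"]] by simp
  then have "(b \<longlongrightarrow> 0) at_infinity"
    unfolding a(2) by (rule tendsto_divide_0[OF tendsto_const])
  then show ?case
    using a by (intro exI[of _ 1] exI[of _ "[:-a, 1:]"] exI[of _ 0]) auto
next
  case (add f g)
  from add.IH obtain p1 q1 l1 p2 q2 l2 where *:
    "q1 \<noteq> 0" "\<forall>z. poly q1 z = 0 \<longrightarrow> z \<in> P" "\<forall>z. poly q1 z \<noteq> 0 \<longrightarrow> f z = poly p1 z / poly q1 z"
    "(f \<longlongrightarrow> l1) at_infinity"
    "q2 \<noteq> 0" "\<forall>z. poly q2 z = 0 \<longrightarrow> z \<in> P" "\<forall>z. poly q2 z \<noteq> 0 \<longrightarrow> g z = poly p2 z / poly q2 z"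
    "(g \<longlongrightarrow> l2) at_infinity" by blast
  then show ?case
    by (intro exI[of _ "p1 * q2 + p2 * q1"] exI[of _ "q1 * q2"] exI[of _ "l1 + l2"])
       (auto simp: add_frac_eq intro!: tendsto_add)
next
  case (mult f g)
  from mult.IH obtain p1 q1 l1 p2 q2 l2 where *:
    "q1 \<noteq> 0" "\<forall>z. poly q1 z = 0 \<longrightarrow> z \<in> P" "\<forall>z. poly q1 z \<noteq> 0 \<longrightarrow> f z = poly p1 z / poly q1 z"
    "(f \<longlongrightarrow> l1) at_infinity"
    "q2 \<noteq> 0" "\<forall>z. poly q2 z = 0 \<longrightarrow> z \<in> P" "\<forall>z. poly q2 z \<noteq> 0 \<longrightarrow> g z = poly p2 z / poly q2 z"
    "(g \<longlongrightarrow> l2) at_infinity" by blast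
  then show ?case
    by (intro exI[of _ "p1 * p2"] exI[of _ "q1 * q2"] exI[of _ "l1 * l2"])
       (auto intro!: tendsto_mult)
qed

text \<open>Take a common divisor \<open>d\<close> of maximal degree: a common factor
  \<open>c\<close> of the cofactors makes \<open>c * d\<close> a common divisor, so \<open>c\<close>
  has degree zero and is a unit.\<close>

lemma poly_coprime_cofactors:
  fixes p q :: "'a :: field poly"
  assumes "q \<noteq> 0"
  obtains p' q' d where "p = p' * d" "q = q' * d" "coprime p' q'"
proof -
  let ?D = "\<lambda>d. d dvd p \<and> d dvd q"
  have "degree d < Suc (degree q)" if "?D d" for d
    using that assms by (simp add: dvd_imp_degree_le less_Suc_eq_le)
  then obtain d where d: "?D d" "\<And>c. ?D c \<Longrightarrow> degree c \<le> degree d"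
    using ex_has_greatest_nat[of ?D 1 degree "Suc (degree q)"] by (auto simp: less_imp_le)
  then obtain p' q' where pq: "p = p' * d" "q = q' * d" by (metis dvd_def mult.commute)
  have "is_unit c" if c: "c dvd p'" "c dvd q'" for c
  proof -
    have "c \<noteq> 0" "d \<noteq> 0" using c pq assms by auto
    moreover have "degree (c * d) \<le> degree d" using c pq by (intro d(2)) (auto intro: mult_dvd_mono)
    ultimately show ?thesis by (simp add: degree_mult_eq is_unit_iff_degree)
  qed
  then have "coprime p' q'" by (rule coprimeI)
  then show thesis using pq that by blast
qed

text \<open>Cancelling common factors gives the form demanded by \<open>complex_rational\<close>.
  Since \<open>R\<close> and \<open>r\<close> can differ only at the finitely many roots of
  \<open>q\<close>, \<open>R\<close> inherits the finite limit and has no pole at infinity.\<close>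

lemma rational_lowest_terms:
  fixes p q :: "complex poly"
  assumes "q \<noteq> 0" and r: "\<And>z. poly q z \<noteq> 0 \<Longrightarrow> r z = poly p z / poly q z"
    and l: "(r \<longlongrightarrow> l) at_infinity"
  obtains R where "complex_rational R" "poles R \<subseteq> Fin ` {z. poly q z = 0}"
    "\<And>z. poly q z \<noteq> 0 \<Longrightarrow> R z = r z"
proof -
  obtain p' q' d where pq: "p = p' * d" "q = q' * d" "coprime p' q'"
    using poly_coprime_cofactors[OF assms(1)] by blast
  define R where "R = (\<lambda>z. poly p' z / poly q' z)"
  have q': "q' \<noteq> 0" using assms(1) pq(2) by auto
  have R_eq: "R z = r z" if "poly q z \<noteq> 0" for z
  proof -
    have "poly p z = poly p' z * poly d z" "poly q z = poly q' z * poly d z"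
      by (simp_all add: pq(1,2))
    then show ?thesis using that r[OF that] by (simp add: R_def)
  qed
  have root: "poly q z = 0" if "poly q' z = 0" for z
    using that by (simp add: pq(2))
  have "complex_rational R" unfolding complex_rational_def
    using q' pq(3) by (intro exI[of _ p'] exI[of _ q']) (auto simp: R_def)
  moreover have "poles R \<subseteq> Fin ` {z. poly q z = 0}"
  proof -
    have "poly q z = 0" if "is_pole R z" for z
    proof (rule ccontr)
      assume "poly q z \<noteq> 0"
      then have "poly q' z \<noteq> 0" using root by blast
      then have "isCont R z" unfolding R_def by (intro continuous_intros)
      then show False using that isCont_not_pole by blast
    qed
    moreover have "\<not> filterlim R at_infinity at_infinity"
    proof -
      have "bounded {z. poly q z = 0}" by (rule finite_imp_bounded[OF poly_roots_finite[OF assms(1)]])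
      then obtain M where M: "\<And>z. poly q z = 0 \<Longrightarrow> norm z \<le> M"
        unfolding bounded_iff by auto
      have "eventually (\<lambda>z. r z = R z) at_infinity"
        unfolding eventually_at_infinity
      proof (intro exI allI impI)
        fix z assume "M + 1 \<le> cmod z"
        then have "poly q z \<noteq> 0" using M[of z] by auto
        then show "r z = R z" by (simp add: R_eq)
      qed
      then have "(R \<longlongrightarrow> l) at_infinity" using l by (rule Lim_transform_eventually[rotated])
      from not_tendsto_and_filterlim_at_infinity[OF trivial_limit_at_infinity this]
      show ?thesis by auto
    qed
    ultimately show ?thesis by (auto simp: poles_def)
  qed
  ultimately show thesis using that R_eq by blast
qed

text \<open>As \<open>P\<close> meets each component, pole pushing puts every
  \<open>1 / (z - \<zeta>)\<close> with \<open>\<zeta> \<notin> K\<close> into the closure, so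
  \<open>mergelyan_clo\<close> applies to the algebra generated by the fractions with poles in
  \<open>P\<close>.\<close>

theorem Mergelyan_rational:
  assumes K: "compact K" and fin: "finite (components (- K))" and f: "f \<in> alg_A K"
    and P: "P \<subseteq> - K" "\<And>C. C \<in> components (- K) \<Longrightarrow> C \<inter> P \<noteq> {}" and "\<epsilon> > 0"
  shows "\<exists>R. complex_rational R \<and> poles R \<subseteq> Fin ` P \<and> (\<forall>z\<in>K. cmod (f z - R z) < \<epsilon>)"
proof -
  let ?B = "(\<lambda>p z. 1 / (z - p)) ` P"
  interpret uniform_algebra K ?B
  proof
    fix b assume "b \<in> ?B"
    then obtain p where p: "p \<in> P" "b = (\<lambda>z. 1 / (z - p))" by blast
    then have "continuous_on K b" using P(1) by (auto intro!: continuous_intros)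
    then show "bounded (b ` K)" using K by (intro compact_imp_bounded compact_continuous_image)
  qed
  have "f \<in> clo"
  proof (rule mergelyan_clo[OF K _ fin])
    have "\<exists>p\<in>C. (\<lambda>z. 1 / (z - p)) \<in> clo" if "C \<in> components (- K)" for C
      using P(2)[OF that] by (auto intro!: gen_alg_subset_clo gen_alg.gen)
    then show "(\<lambda>z. 1 / (z - \<zeta>)) \<in> clo" if "\<zeta> \<notin> K" for \<zeta>
      using clo_all_poles[OF K _ that] by blast
  qed (use f in \<open>auto simp: alg_A_def\<close>)
  then obtain r where r: "r \<in> gen_alg ?B" "\<And>z. z \<in> K \<Longrightarrow> cmod (f z - r z) < \<epsilon>"
    using cloD \<open>\<epsilon> > 0\<close> by blast
  obtain p q l where pq: "q \<noteq> 0" "\<And>z. poly q z = 0 \<Longrightarrow> z \<in> P"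
    "\<And>z. poly q z \<noteq> 0 \<Longrightarrow> r z = poly p z / poly q z" "(r \<longlongrightarrow> l) at_infinity"
    using gen_alg_inverse_rational[OF r(1)] by blast
  obtain R where R: "complex_rational R" "poles R \<subseteq> Fin ` {z. poly q z = 0}"
    "\<And>z. poly q z \<noteq> 0 \<Longrightarrow> R z = r z"
    using rational_lowest_terms[OF pq(1,3,4)] by blast
  show ?thesis
  proof (intro exI conjI ballI)
    show "complex_rational R" by (rule R(1))
    show "poles R \<subseteq> Fin ` P" using R(2) pq(2) by blast
    show "cmod (f z - R z) < \<epsilon>" if "z \<in> K" for z
    proof -
      have "poly q z \<noteq> 0" using pq(2)[of z] P(1) that by blast
      then show ?thesis using r(2)[OF that] by (simp add: R(3))
    qed
  qed
qed

text \<open>One fraction, with a pole \<open>a\<close> of modulus \<open>2 * M\<close>, is a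
  geometric series in \<open>z\<close>; connectedness of the complement carries the pole to every
  other point off \<open>K\<close>.\<close>

theorem Mergelyan_polynomial:
  assumes K: "compact K" and conn: "connected (- K)" and f: "f \<in> alg_A K" and "\<epsilon> > 0"
  obtains p where "\<And>z. z \<in> K \<Longrightarrow> cmod (f z - poly p z) < \<epsilon>"
proof -
  obtain M where M: "M > 0" "\<And>z. z \<in> K \<Longrightarrow> cmod z \<le> M"
    using compact_imp_bounded[OF K] unfolding bounded_pos by auto
  interpret uniform_algebra K "{\<lambda>z. z}"
    by unfold_locales (use compact_imp_bounded[OF K] in auto)
  define a :: complex where "a = of_real (2 * M)"
  have a: "a \<noteq> 0" "cmod a = 2 * M" using M(1) by (simp_all add: a_def)
  have "a \<notin> K" using M a by force
  then have comps: "components (- K) = {- K}" using conn by (auto simp: components_eq_sing_iff)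
  have "(\<lambda>z. 1 / (1 - 1 / a * z)) \<in> clo"
  proof (rule clo_geometric)
    show "(\<lambda>z. 1 / a * z) \<in> clo" by (intro clo_cmult gen_alg_subset_clo gen_alg.gen) simp
    show "cmod (1 / a * z) \<le> 1 / 2" if "z \<in> K" for z
      using M(1) M(2)[OF that] a by (simp add: norm_divide divide_simps)
  qed
  then have "(\<lambda>z. - (1 / a) * (1 / (1 - 1 / a * z))) \<in> clo" by (rule clo_cmult)
  moreover have "- (1 / a) * (1 / (1 - 1 / a * z)) = 1 / (z - a)" for z
  proof -
    have "- a * (1 - 1 / a * z) = z - a" using a(1) by (simp add: field_simps)
    then show ?thesis by (metis mult_minus_left mult_1 times_divide_times_eq minus_divide_right)
  qed
  ultimately have a_clo: "(\<lambda>z. 1 / (z - a)) \<in> clo" by simp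
  have "f \<in> clo"
  proof (rule mergelyan_clo[OF K])
    show "(\<lambda>z. 1 / (z - \<zeta>)) \<in> clo" if "\<zeta> \<notin> K" for \<zeta>
      by (rule clo_all_poles[OF K _ that]) (use comps a_clo \<open>a \<notin> K\<close> in auto)
  qed (use f comps in \<open>auto simp: alg_A_def\<close>)
  then obtain r where r: "r \<in> gen_alg {\<lambda>z. z}" "\<And>z. z \<in> K \<Longrightarrow> cmod (f z - r z) < \<epsilon>"
    using cloD \<open>\<epsilon> > 0\<close> by blast
  have "\<exists>p. r = poly p" using r(1)
  proof (induction rule: gen_alg.induct)
    case (const c)
    show ?case by (rule exI[of _ "[:c:]"]) auto
  next
    case (gen b)
    then show ?case by (intro exI[of _ "[:0, 1:]"]) auto
  next
    case (add f g)
    then show ?case by (metis poly_add)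
  next
    case (mult f g)
    then show ?case by (metis poly_mult)
  qed
  then show thesis using r(2) that by blast
qed

lemma poles_poly: "poles (poly p) \<subseteq> {Infty}"
  using isCont_not_pole[OF poly_isCont, of p] by (auto simp: poles_def)

section \<open>Hyperbolic suprema and projections of product components\<close>

lemma is_nonneg_sup_exists:
  assumes "0 \<le> b" "\<And>x. x \<in> A \<Longrightarrow> 0 \<le> x \<and> x \<le> b"
  obtains s where "is_nonneg_sup A s" "s \<le> b"
proof (cases "A = {}")
  \<comment> \<open>This case arises when \<open>K1\<close> or \<open>K2\<close> is empty; the
    supremum is then \<open>0\<close>.\<close>
  case True
  then show thesis using that[of 0] assms(1) by (simp add: is_nonneg_sup_def)
next
  case False
  have "bdd_above A" "\<forall>x\<in>A. 0 \<le> x" using assms(2) by (auto intro!: bdd_aboveI[of _ b])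
  then have "is_nonneg_sup A (Sup A)" using is_nonneg_sup_Sup[OF False] by simp
  moreover have "Sup A \<le> b" using False assms(2) by (intro cSup_least) auto
  ultimately show thesis using that by blast
qed

text \<open>Pointwise bounds below \<open>\<epsilon> / 2\<close> give suprema at most
  \<open>\<epsilon> / 2\<close>; the halving secures the strict inequality in both
  components.\<close>

lemma hsup_dist_less_idem_fun:
  assumes F: "\<And>Z. Z \<in> idem_prod K1 K2 \<Longrightarrow> F Z = idem_fun F1 F2 Z" and "\<epsilon> > 0"
    and R1: "\<And>z. z \<in> K1 \<Longrightarrow> cmod (F1 z - R1 z) < \<epsilon> / 2"
    and R2: "\<And>z. z \<in> K2 \<Longrightarrow> cmod (F2 z - R2 z) < \<epsilon> / 2"
  shows "hsup_dist_less (idem_prod K1 K2) F (idem_fun R1 R2) \<epsilon>"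
proof -
  let ?S = "(\<lambda>Z. hnorm (F Z - idem_fun R1 R2 Z)) ` idem_prod K1 K2"
  have comp: "Re (bc_Pi1 (hnorm (F Z - idem_fun R1 R2 Z))) \<in> {0..\<epsilon>/2} \<and>
      Re (bc_Pi2 (hnorm (F Z - idem_fun R1 R2 Z))) \<in> {0..\<epsilon>/2}" if "Z \<in> idem_prod K1 K2" for Z
  proof -
    have "bc_Pi1 Z \<in> K1" "bc_Pi2 Z \<in> K2" using that by (auto simp: idem_prod_def)
    then show ?thesis using R1 R2 F[OF that] by (force simp: hnorm_def idem_fun_def)
  qed
  obtain s1 where s1: "is_nonneg_sup ((\<lambda>Z. Re (bc_Pi1 Z)) ` ?S) s1" "s1 \<le> \<epsilon>/2"
    by (rule is_nonneg_sup_exists[where A = "(\<lambda>Z. Re (bc_Pi1 Z)) ` ?S" and b = "\<epsilon>/2"])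
       (use comp \<open>\<epsilon> > 0\<close> in auto)
  obtain s2 where s2: "is_nonneg_sup ((\<lambda>Z. Re (bc_Pi2 Z)) ` ?S) s2" "s2 \<le> \<epsilon>/2"
    by (rule is_nonneg_sup_exists[where A = "(\<lambda>Z. Re (bc_Pi2 Z)) ` ?S" and b = "\<epsilon>/2"])
       (use comp \<open>\<epsilon> > 0\<close> in auto)
  let ?s = "bc_idem (of_real s1) (of_real s2)"
  have "is_hsup ?S ?s" using s1(1) s2(1) by (simp add: is_hsup_def hyperbolic_def)
  moreover have "?s \<prec>\<^sub>h bc_of_complex (of_real \<epsilon>)"
    using s1(2) s2(2) \<open>\<epsilon> > 0\<close> by (simp add: hless_def hyperbolic_def bc_of_complex_idem)
  ultimately show ?thesis unfolding hsup_dist_less_def by blast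
qed

text \<open>The projections are continuous, so the component of \<open>prod_compl K1 K2\<close> through a point over
  \<open>C\<close> projects into \<open>C\<close>; the components of the product themselves need not be identified.\<close>

lemma component_meets_projection:
  assumes "compact K1" "compact K2"
    and P: "P \<subseteq> prod_compl K1 K2" "\<And>C. C \<in> components (prod_compl K1 K2) \<Longrightarrow> \<exists>Z\<in>P. Z \<in> C"
  shows "C \<in> components (- K1) \<Longrightarrow> C \<inter> bc_Pi1 ` P \<noteq> {}"
    and "C \<in> components (- K2) \<Longrightarrow> C \<inter> bc_Pi2 ` P \<noteq> {}"
proof -
  \<comment> \<open>A point of \<open>C\<close> is lifted to the product complement by pairing it
    with a point outside the other compact set, which cannot be the whole plane.\<close>
  have ne: "\<exists>z. z \<in> - K" if K: "compact K" for K :: "complex set"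
  proof -
    have "K \<noteq> UNIV" using K not_bounded_UNIV[where 'a = complex] compact_imp_bounded by auto
    then show ?thesis by auto
  qed
  have sub: "bc_Pi1 ` prod_compl K1 K2 \<subseteq> - K1" "bc_Pi2 ` prod_compl K1 K2 \<subseteq> - K2"
    by (auto simp: prod_compl_def idem_prod_def)
  have key: "C \<inter> \<pi> ` P \<noteq> {}"
    if C: "C \<in> components (- K)" and W: "W \<in> prod_compl K1 K2" "\<pi> W \<in> C"
      and \<pi>: "continuous_on UNIV \<pi>" "\<pi> ` prod_compl K1 K2 \<subseteq> - K" for C K W and \<pi> :: "bicomplex \<Rightarrow> complex"
  proof -
    let ?D = "connected_component_set (prod_compl K1 K2) W"
    have "?D \<in> components (prod_compl K1 K2)" using W(1) by (rule componentsI)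
    then obtain Z where Z: "Z \<in> P" "Z \<in> ?D" using P(2) by blast
    have "connected (\<pi> ` ?D)"
      using \<pi>(1) by (intro connected_continuous_image) (auto intro: continuous_on_subset)
    moreover have "\<pi> ` ?D \<subseteq> - K" using \<pi>(2) connected_component_subset by fastforce
    moreover have "C \<inter> \<pi> ` ?D \<noteq> {}" using W by auto
    ultimately have "\<pi> ` ?D \<subseteq> C" using components_maximal[OF C] by blast
    then show ?thesis using Z by blast
  qed
  show "C \<inter> bc_Pi1 ` P \<noteq> {}" if C: "C \<in> components (- K1)"
  proof -
    obtain z w where "z \<in> C" "w \<in> - K2" using in_components_nonempty[OF C] ne[OF assms(2)] by blast
    then show ?thesis
      using in_components_subset[OF C]
      by (intro key[OF C, of "bc_idem z w"] continuous_on_bc_Pi sub) (auto simp: prod_compl_def idem_prod_def)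
  qed
  show "C \<inter> bc_Pi2 ` P \<noteq> {}" if C: "C \<in> components (- K2)"
  proof -
    obtain z w where "w \<in> C" "z \<in> - K1" using in_components_nonempty[OF C] ne[OF assms(1)] by blast
    then show ?thesis
      using in_components_subset[OF C]
      by (intro key[OF C, of "bc_idem z w"] continuous_on_bc_Pi sub) (auto simp: prod_compl_def idem_prod_def)
  qed
qed

theorem theorem3p1:
  fixes K1 K2 :: "complex set" and K :: "bicomplex set"
    and F :: "bicomplex \<Rightarrow> bicomplex" and \<epsilon> :: real
  assumes "compact K1" and "compact K2" and "K = idem_prod K1 K2"
    and "F \<in> bc_alg_A K1 K2"
    and "\<epsilon> > 0"
  shows
   "(compl_type1 K1 K2 \<longrightarrow>
      (\<forall>P. P \<subseteq> prod_compl K1 K2 \<and> (\<forall>C\<in>components (prod_compl K1 K2). \<exists>Z\<in>P. Z \<in> C) \<longrightarrow>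
        (\<exists>R R1 R2. R = idem_fun R1 R2 \<and> complex_rational R1 \<and> complex_rational R2 \<and>
           poles R1 \<subseteq> Fin ` bc_Pi1 ` P \<and> poles R2 \<subseteq> Fin ` bc_Pi2 ` P \<and>
           hsup_dist_less K F R \<epsilon>)))
    \<and> (compl_type2 K1 K2 \<longrightarrow>
        (\<exists>R R1 P2. R = idem_fun R1 P2 \<and> complex_rational R1 \<and> complex_polynomial P2 \<and>
           poles R1 \<subseteq> Fin ` (- K1) \<and> poles P2 \<subseteq> {Infty} \<and>
           hsup_dist_less K F R \<epsilon>))
    \<and> (compl_type3 K1 K2 \<longrightarrow>
        (\<exists>R P1 R2. R = idem_fun P1 R2 \<and> complex_polynomial P1 \<and> complex_rational R2 \<and>
           poles P1 \<subseteq> {Infty} \<and> poles R2 \<subseteq> Fin ` (- K2) \<and>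
           hsup_dist_less K F R \<epsilon>))
    \<and> (compl_type4 K1 K2 \<longrightarrow>
        (\<exists>P P1 P2. P = idem_fun P1 P2 \<and> complex_polynomial P1 \<and> complex_polynomial P2 \<and>
           poles P1 \<subseteq> {Infty} \<and> poles P2 \<subseteq> {Infty} \<and>
           hsup_dist_less K F P \<epsilon>))"
proof -
  obtain F1 F2 where F: "F1 \<in> alg_A K1" "F2 \<in> alg_A K2"
    "\<And>Z. Z \<in> idem_prod K1 K2 \<Longrightarrow> F Z = idem_fun F1 F2 Z"
    using assms(4) unfolding bc_alg_A_def by blast
  have e: "\<epsilon> / 2 > 0" using assms(5) by simp
  have combine: "hsup_dist_less K F (idem_fun R1 R2) \<epsilon>"
    if "\<And>z. z \<in> K1 \<Longrightarrow> cmod (F1 z - R1 z) < \<epsilon> / 2" "\<And>z. z \<in> K2 \<Longrightarrow> cmod (F2 z - R2 z) < \<epsilon> / 2"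
    for R1 R2
    unfolding assms(3) using that by (intro hsup_dist_less_idem_fun[OF _ assms(5)]) (rule F(3))
  have rat: "\<exists>R. complex_rational R \<and> poles R \<subseteq> Fin ` (- L) \<and> (\<forall>z\<in>L. cmod (f z - R z) < \<epsilon> / 2)"
    if L: "compact L" "finite (components (- L))" "f \<in> alg_A L" for L f
  proof -
    have "C \<inter> - L \<noteq> {}" if "C \<in> components (- L)" for C
      using in_components_subset[OF that] in_components_nonempty[OF that] by blast
    from Mergelyan_rational[OF L order_refl this e] show ?thesis .
  qed
  have pol: "\<exists>p. complex_polynomial p \<and> poles p \<subseteq> {Infty} \<and> (\<forall>z\<in>L. cmod (f z - p z) < \<epsilon> / 2)"
    if L: "compact L" "connected (- L)" "f \<in> alg_A L" for L f
    using Mergelyan_polynomial[OF L e] poles_poly unfolding complex_polynomial_def by metis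
  show ?thesis
  proof (intro conjI impI allI)
    fix P assume "compl_type1 K1 K2" and P: "P \<subseteq> prod_compl K1 K2 \<and> (\<forall>C\<in>components (prod_compl K1 K2). \<exists>Z\<in>P. Z \<in> C)"
    then have fin: "finite (components (- K1))" "finite (components (- K2))" by (auto simp: compl_type1_def)
    have sub: "bc_Pi1 ` P \<subseteq> - K1" "bc_Pi2 ` P \<subseteq> - K2"
      using P by (auto simp: prod_compl_def idem_prod_def)
    have PC: "\<And>C. C \<in> components (prod_compl K1 K2) \<Longrightarrow> \<exists>Z\<in>P. Z \<in> C" using P by simp
    have meets: "C \<in> components (- K1) \<Longrightarrow> C \<inter> bc_Pi1 ` P \<noteq> {}"
      "C \<in> components (- K2) \<Longrightarrow> C \<inter> bc_Pi2 ` P \<noteq> {}" for C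
      using component_meets_projection[OF assms(1,2) conjunct1[OF P] PC] by simp_all
    obtain R1 where R1: "complex_rational R1" "poles R1 \<subseteq> Fin ` bc_Pi1 ` P"
      "\<And>z. z \<in> K1 \<Longrightarrow> cmod (F1 z - R1 z) < \<epsilon> / 2"
      using Mergelyan_rational[OF assms(1) fin(1) F(1) sub(1) meets(1) e] by auto
    obtain R2 where R2: "complex_rational R2" "poles R2 \<subseteq> Fin ` bc_Pi2 ` P"
      "\<And>z. z \<in> K2 \<Longrightarrow> cmod (F2 z - R2 z) < \<epsilon> / 2"
      using Mergelyan_rational[OF assms(2) fin(2) F(2) sub(2) meets(2) e] by auto
    show "\<exists>R R1 R2. R = idem_fun R1 R2 \<and> complex_rational R1 \<and> complex_rational R2 \<and>
           poles R1 \<subseteq> Fin ` bc_Pi1 ` P \<and> poles R2 \<subseteq> Fin ` bc_Pi2 ` P \<and> hsup_dist_less K F R \<epsilon>"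
      using R1(1,2) R2(1,2) combine[OF R1(3) R2(3)] by blast
  next
    assume "compl_type2 K1 K2"
    then have c: "finite (components (- K1))" "connected (- K2)" by (simp_all add: compl_type2_def)
    obtain R1 where R1: "complex_rational R1" "poles R1 \<subseteq> Fin ` (- K1)" "\<And>z. z \<in> K1 \<Longrightarrow> cmod (F1 z - R1 z) < \<epsilon> / 2"
      using rat[OF assms(1) c(1) F(1)] by blast
    obtain P2 where P2: "complex_polynomial P2" "poles P2 \<subseteq> {Infty}" "\<And>z. z \<in> K2 \<Longrightarrow> cmod (F2 z - P2 z) < \<epsilon> / 2"
      using pol[OF assms(2) c(2) F(2)] by blast
    show "\<exists>R R1 P2. R = idem_fun R1 P2 \<and> complex_rational R1 \<and> complex_polynomial P2 \<and>
           poles R1 \<subseteq> Fin ` (- K1) \<and> poles P2 \<subseteq> {Infty} \<and> hsup_dist_less K F R \<epsilon>"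
      using R1(1,2) P2(1,2) combine[OF R1(3) P2(3)] by blast
  next
    assume "compl_type3 K1 K2"
    then have c: "connected (- K1)" "finite (components (- K2))" by (simp_all add: compl_type3_def)
    obtain P1 where P1: "complex_polynomial P1" "poles P1 \<subseteq> {Infty}" "\<And>z. z \<in> K1 \<Longrightarrow> cmod (F1 z - P1 z) < \<epsilon> / 2"
      using pol[OF assms(1) c(1) F(1)] by blast
    obtain R2 where R2: "complex_rational R2" "poles R2 \<subseteq> Fin ` (- K2)" "\<And>z. z \<in> K2 \<Longrightarrow> cmod (F2 z - R2 z) < \<epsilon> / 2"
      using rat[OF assms(2) c(2) F(2)] by blast
    show "\<exists>R P1 R2. R = idem_fun P1 R2 \<and> complex_polynomial P1 \<and> complex_rational R2 \<and>
           poles P1 \<subseteq> {Infty} \<and> poles R2 \<subseteq> Fin ` (- K2) \<and> hsup_dist_less K F R \<epsilon>"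
      using P1(1,2) R2(1,2) combine[OF P1(3) R2(3)] by blast
  next
    assume "compl_type4 K1 K2"
    then have c: "connected (- K1)" "connected (- K2)" by (simp_all add: compl_type4_def)
    obtain P1 where P1: "complex_polynomial P1" "poles P1 \<subseteq> {Infty}" "\<And>z. z \<in> K1 \<Longrightarrow> cmod (F1 z - P1 z) < \<epsilon> / 2"
      using pol[OF assms(1) c(1) F(1)] by blast
    obtain P2 where P2: "complex_polynomial P2" "poles P2 \<subseteq> {Infty}" "\<And>z. z \<in> K2 \<Longrightarrow> cmod (F2 z - P2 z) < \<epsilon> / 2"
      using pol[OF assms(2) c(2) F(2)] by blast
    show "\<exists>P P1 P2. P = idem_fun P1 P2 \<and> complex_polynomial P1 \<and> complex_polynomial P2 \<and>
           poles P1 \<subseteq> {Infty} \<and> poles P2 \<subseteq> {Infty} \<and> hsup_dist_less K F P \<epsilon>"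
      using P1(1,2) P2(1,2) combine[OF P1(3) P2(3)] by blast
  qed
qed

end
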